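(* Let $N\ge 1$ and let $H:\mathbf{R}^N\to(0,1)$ be a measurable function. Let $X=\{X_t;\,t\in\mathbf{R}_+^N\}$ be the multifractional Brownian field defined by the moving average representation $$X_t=\int_{\mathbf{R}^N}\left[\|t-u\|^{H(t)-\frac N2}-\|u\|^{H(t)-\frac N2}\right]\mathbb{W}(du),$$ and let $Y=\{Y_t;\,t\in\mathbf{R}_+^N\}$ be the process $$Y_t=\int_{\mathbf{R}^N}\frac{e^{i\langle t,\xi\rangle}-1}{\|\xi\|^{H(t)+\frac N2}}\,\hat{\mathbb{W}}(d\xi).$$ Then $X$ and $Y$ are indistinguishable up to a multiplicative deterministic function; that is, there is a deterministic function $\lambda$ on $\mathbf{R}_+^N$ such that the processes $\{X_t\}$ and $\{\lambda(t)Y_t\}$ are indistinguishable.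
   Context: $\mathbf{R}_+=[0,\infty)$; $\|\cdot\|$ and $\langle\cdot,\cdot\rangle$ are the Euclidean norm and inner product on $\mathbf{R}^N$. $L^2_{\mathbf C}(\mathbf{R}^N)$ is the space of square-integrable functions $\mathbf{R}^N\to\mathbf{C}$. The complex isonormal process is a centered Gaussian process $W=\{W(f);f\in L^2_{\mathbf C}(\mathbf{R}^N)\}$ (linear in $f$, with $W(f)$ almost surely real for real $f$) such that $E[W(f)\overline{W(g)}]=\int_{\mathbf{R}^N}f(u)\overline{g(u)}\,du$ for all $f,g$. White noise is $\mathbb{W}(E)=W(\mathbf 1_E)$, and $\int f(u)\,\mathbb{W}(du)=W(f)$. The Fourier transform of $W$ is the process $\hat W(f)=W(\hat f)$, where $\hat f$ is the Fourier transform of $f$; the Fourier transform $\hat{\mathbb{W}}$ of white noise is defined in the same way, and $\int f(\xi)\,\hat{\mathbb{W}}(d\xi)=\hat W(f)$. Here $\mathbb{W}$ and $\hat{\mathbb{W}}$ come from the same isonormal process $W$. Two processes are indistinguishable if almost surely they coincide for all $t$ simultaneously. *)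

theory Defs
  imports "HOL-Probability.Probability"
begin

text \<open>Square-integrable functions, i.e. representatives of the elements of the complex \<open>L\<^sup>2\<close>
  space. Using Borel measurable representatives is no restriction, as every Lebesgue measurable
  function agrees almost everywhere with a Borel measurable one.\<close>

definition L2 :: "('a::euclidean_space \<Rightarrow> complex) set" where
  "L2 = {f. f \<in> borel_measurable borel \<and> integrable lborel (\<lambda>u. (norm (f u))\<^sup>2)}"

text \<open>The \<open>L\<^sup>2\<close> Fourier transform with kernel \<open>exp (- i \<langle>x, \<xi>\<rangle>)\<close>: the limit in \<open>L\<^sup>2\<close> of the Fourier
  integrals of the truncations of \<open>f\<close> to balls, which are integrable for \<open>f\<close> in \<open>L\<^sup>2\<close>. The limit is
  unique up to almost everywhere equality, and a representative is chosen. The distance is a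
  nonnegative (extended) integral because the Bochner integral of a non-integrable function is
  \<open>0\<close>.\<close>

definition fourier_integral :: "('a::euclidean_space \<Rightarrow> complex) \<Rightarrow> 'a \<Rightarrow> complex" where
  "fourier_integral f \<xi> = (\<integral>x. cis (- (x \<bullet> \<xi>)) * f x \<partial>lborel)"

definition is_fourier_L2 ::
    "('a::euclidean_space \<Rightarrow> complex) \<Rightarrow> ('a \<Rightarrow> complex) \<Rightarrow> bool" where
  "is_fourier_L2 f g \<longleftrightarrow> g \<in> L2 \<and>
     ((\<lambda>R::real. \<integral>\<^sup>+\<xi>. ennreal ((norm (g \<xi> -
          fourier_integral (\<lambda>x. indicator (cball 0 R) x * f x) \<xi>))\<^sup>2) \<partial>lborel) \<longlongrightarrow> 0) at_top"

definition fourier_L2 :: "('a::euclidean_space \<Rightarrow> complex) \<Rightarrow> 'a \<Rightarrow> complex" where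
  "fourier_L2 f = (SOME g. is_fourier_L2 f g)"

text \<open>Centered Gaussian variables may be degenerate (variance \<open>0\<close>).\<close>

definition centered_gaussian :: "'w measure \<Rightarrow> ('w \<Rightarrow> real) \<Rightarrow> bool" where
  "centered_gaussian M Z \<longleftrightarrow> Z \<in> borel_measurable M \<and>
     ((AE \<omega> in M. Z \<omega> = 0) \<or> (\<exists>\<sigma>>0. distributed M lborel Z (normal_density 0 \<sigma>)))"

text \<open>A complex process is centered Gaussian if its real and imaginary parts are jointly so.\<close>

definition centered_gaussian_process ::
    "'w measure \<Rightarrow> 'i set \<Rightarrow> ('i \<Rightarrow> 'w \<Rightarrow> complex) \<Rightarrow> bool" where
  "centered_gaussian_process M I W \<longleftrightarrow>
     (\<forall>F a b. finite F \<and> F \<subseteq> I \<longrightarrow>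
        centered_gaussian M (\<lambda>\<omega>. \<Sum>f\<in>F. a f * Re (W f \<omega>) + b f * Im (W f \<omega>)))"

text \<open>The process is indexed by \<open>L\<^sup>2\<close>, whose elements are functions up to almost everywhere equality,
  and is linear in its index. Both requirements concern the map \<open>f \<mapsto> W f \<omega>\<close>: the exceptional
  null set does not depend on the functions and scalars. If it did, the values of \<open>W\<close> at
  uncountably many indices could not be compared simultaneously.\<close>

locale complex_isonormal = prob_space M
  for M :: "'w measure" and W :: "('a::euclidean_space \<Rightarrow> complex) \<Rightarrow> 'w \<Rightarrow> complex" +
  assumes gaussian: "centered_gaussian_process M L2 W"
    and AE_cong: "AE \<omega> in M. \<forall>f\<in>L2. \<forall>g\<in>L2. (AE u in lborel. f u = g u) \<longrightarrow> W f \<omega> = W g \<omega>"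
    and linear: "AE \<omega> in M. \<forall>f\<in>L2. \<forall>g\<in>L2. \<forall>a b.
        W (\<lambda>u. a * f u + b * g u) \<omega> = a * W f \<omega> + b * W g \<omega>"
    and real: "f \<in> L2 \<Longrightarrow> (\<forall>u. f u \<in> \<real>) \<Longrightarrow> AE \<omega> in M. W f \<omega> \<in> \<real>"
    and covariance: "f \<in> L2 \<Longrightarrow> g \<in> L2 \<Longrightarrow>
        (\<integral>\<omega>. W f \<omega> * cnj (W g \<omega>) \<partial>M) = (\<integral>u. f u * cnj (g u) \<partial>lborel)"

text \<open>Integrals of \<open>f\<close> against the white noise \<open>E \<mapsto> W (indicator E)\<close> and against its Fourier transform
  are by definition \<open>W f\<close> and \<open>fourier_process W f\<close>.\<close>

definition fourier_process ::
    "(('a::euclidean_space \<Rightarrow> complex) \<Rightarrow> 'w \<Rightarrow> complex) \<Rightarrow> ('a \<Rightarrow> complex) \<Rightarrow> 'w \<Rightarrow> complex" where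
  "fourier_process W f = W (fourier_L2 f)"

definition nonneg_orthant :: "(real ^ 'n) set" where
  "nonneg_orthant = {t. \<forall>i. 0 \<le> t $ i}"

text \<open>At the points where a kernel below is singular (\<open>u = t\<close>, \<open>u = 0\<close> or \<open>\<xi> = 0\<close>) it takes a
  junk value; these points form a null set.\<close>

definition moving_average_field ::
    "(real ^ 'n \<Rightarrow> real) \<Rightarrow> ((real ^ 'n \<Rightarrow> complex) \<Rightarrow> 'w \<Rightarrow> complex) \<Rightarrow> real ^ 'n \<Rightarrow> 'w \<Rightarrow> complex" where
  "moving_average_field H W t =
     W (\<lambda>u. of_real (norm (t - u) powr (H t - real CARD('n) / 2)
                      - norm u powr (H t - real CARD('n) / 2)))"

definition harmonizable_field ::
    "(real ^ 'n \<Rightarrow> real) \<Rightarrow> ((real ^ 'n \<Rightarrow> complex) \<Rightarrow> 'w \<Rightarrow> complex) \<Rightarrow> real ^ 'n \<Rightarrow> 'w \<Rightarrow> complex" where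
  "harmonizable_field H W t =
     fourier_process W (\<lambda>\<xi>. (exp (\<i> * of_real (t \<bullet> \<xi>)) - 1)
                              / of_real (norm \<xi> powr (H t + real CARD('n) / 2)))"

definition indistinguishable ::
    "'w measure \<Rightarrow> 't set \<Rightarrow> ('t \<Rightarrow> 'w \<Rightarrow> 'b) \<Rightarrow> ('t \<Rightarrow> 'w \<Rightarrow> 'b) \<Rightarrow> bool" where
  "indistinguishable M T X Y \<longleftrightarrow> (AE \<omega> in M. \<forall>t\<in>T. X t \<omega> = Y t \<omega>)"

end

theory Submission
  imports Defs
begin

text \<open>Put \<open>a = H(t) + N/2\<close> and \<open>f(\<xi>) = (exp(i \<langle>t, \<xi>\<rangle>) - 1) / |\<xi>|^a\<close>. Up to the factor \<open>\<Gamma>(a/2)\<close>, \<open>|\<xi>|^(-a)\<close> is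
  \<open>\<integral> s^(a/2 - 1) exp(- s |\<xi>|^2) ds\<close> over \<open>s > 0\<close>. Restricting \<open>s\<close> to \<open>[1/n, n]\<close> gives integrable
  functions that increase to \<open>f\<close> in modulus and whose Fourier transforms are integrals of differences
  of Gaussians centered at \<open>t\<close> and \<open>0\<close>; these converge pointwise to \<open>C (|t - u|^(H(t) - N/2) - |u|^(H(t) - N/2))\<close>
  with a real constant \<open>C \<noteq> 0\<close>. The bound \<open>\<parallel>F h\<parallel>^2 \<le> (2 \<pi>)^N \<parallel>h\<parallel>^2\<close> for the Fourier transform \<open>F\<close> and Fatou's lemma
  identify this pointwise limit with the \<open>L\<^sup>2\<close> Fourier transform of \<open>f\<close>, so that \<open>l(t) = 1/C\<close> works. The
  one exception is \<open>N = 1\<close>, \<open>H(t) = 1/2\<close> (a pole of \<open>C\<close>): there the moving average kernel vanishes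
  almost everywhere and \<open>l(t) = 0\<close> works.\<close>

section \<open>Gaussian integrals\<close>

text \<open>Lebesgue measure is the image of the product of its one-dimensional copies under the
  coordinate map \<open>g \<mapsto> \<Sum>b\<in>Basis. g b *\<^sub>R b\<close>, so Fubini for finite
  products applies. This reduces Gaussian integrals to dimension one.\<close>

lemma has_bochner_integral_lborel_prod:
  fixes f :: "'a::euclidean_space \<Rightarrow> real \<Rightarrow> 'b::{real_normed_field,banach,second_countable_topology}"
  assumes int: "\<And>b. b \<in> Basis \<Longrightarrow> integrable lborel (f b)"
  shows "has_bochner_integral lborel (\<lambda>x. \<Prod>b\<in>Basis. f b (x \<bullet> b)) (\<Prod>b\<in>Basis. \<integral>x. f b x \<partial>lborel)"
proof -
  interpret product_sigma_finite "\<lambda>_::'a. lborel :: real measure" ..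
  have [measurable]: "f b \<in> borel_measurable borel" if "b \<in> Basis" for b
    using int[OF that, THEN borel_measurable_integrable] by simp
  have meas: "(\<lambda>x. \<Prod>b\<in>Basis. f b (x \<bullet> b)) \<in> borel_measurable borel"
    by measurable
  have T: "(\<lambda>g. \<Sum>b\<in>Basis. g b *\<^sub>R b) \<in> (\<Pi>\<^sub>M b\<in>(Basis::'a set). (lborel::real measure)) \<rightarrow>\<^sub>M borel"
    by measurable
  have eq: "(\<Sum>b\<in>Basis. g b *\<^sub>R b) \<bullet> c = g c" if "c \<in> Basis" for g :: "'a \<Rightarrow> real" and c
    using that by simp
  have "has_bochner_integral (\<Pi>\<^sub>M b\<in>(Basis::'a set). lborel) (\<lambda>g. \<Prod>b\<in>Basis. f b (g b))
      (\<Prod>b\<in>Basis. \<integral>x. f b x \<partial>lborel)"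
    unfolding has_bochner_integral_iff
    by (intro conjI product_integrable_prod product_integral_prod int finite_Basis)
  moreover have "(\<lambda>g. \<Prod>b\<in>Basis. f b (g b)) = (\<lambda>g. \<Prod>b\<in>Basis. f b ((\<Sum>b\<in>Basis. g b *\<^sub>R b) \<bullet> b))"
    by (rule ext, rule prod.cong[OF refl], simp only: eq)
  ultimately have "has_bochner_integral (distr (\<Pi>\<^sub>M b\<in>(Basis::'a set). lborel) borel (\<lambda>g. \<Sum>b\<in>Basis. g b *\<^sub>R b))
     (\<lambda>x. \<Prod>b\<in>Basis. f b (x \<bullet> b)) (\<Prod>b\<in>Basis. \<integral>x. f b x \<partial>lborel)"
    by (simp only: has_bochner_integral_distr[OF meas T])
  then show ?thesis
    by (simp only: lborel_eq[symmetric])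
qed

text \<open>Up to an affine substitution and a constant factor, this is the characteristic function
  \<open>exp (- (t^2) / 2)\<close> of the standard normal distribution.\<close>

lemma has_bochner_integral_gaussian_fourier_real:
  fixes y s :: real
  assumes s: "0 < s"
  shows "has_bochner_integral lborel (\<lambda>x. cis (- (x * y)) * of_real (exp (- s * x\<^sup>2)))
    (of_real (sqrt (pi / s) * exp (- y\<^sup>2 / (4 * s))))"
proof -
  define c where "c = sqrt (2 * s)"
  have c: "0 < c" "c\<^sup>2 = 2 * s" using s by (auto simp: c_def)
  \<comment> \<open>After substituting \<open>c * x\<close> for \<open>x\<close>, the choice
    \<open>c\<^sup>2 = 2 * s\<close> turns the normal density into a multiple of
    \<open>exp (- s * x\<^sup>2)\<close>, and this frequency turns the phase into
    \<open>- (x * y)\<close>.\<close>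
  define t where "t = - y / c"
  interpret N: prob_space std_normal_distribution
    by (rule prob_space_normal_density) simp
  have "integrable std_normal_distribution (\<lambda>x. iexp (t * x))"
    by (rule N.integrable_const_bound[where B=1]) auto
  then have "has_bochner_integral std_normal_distribution (\<lambda>x. iexp (t * x)) (of_real (exp (- (t^2) / 2)))"
    using fun_cong[OF char_std_normal_distribution, of t]
    by (simp add: has_bochner_integral_iff char_def)
  then have "has_bochner_integral lborel (\<lambda>x. std_normal_density x *\<^sub>R iexp (t * x)) (of_real (exp (- (t^2) / 2)))"
    by (simp add: has_bochner_integral_iff integral_density integrable_density normal_density_nonneg)
  then have "has_bochner_integral lborel (\<lambda>x. std_normal_density (0 + c * x) *\<^sub>R iexp (t * (0 + c * x)))
      (of_real (exp (- (t^2) / 2)) /\<^sub>R \<bar>c\<bar>)"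
    by (rule iffD1[OF lborel_has_bochner_integral_real_affine_iff, rotated]) (use c in simp)
  \<comment> \<open>The factor \<open>sqrt (2 * pi)\<close> cancels the normalisation of the
    density.\<close>
  then have "has_bochner_integral lborel (\<lambda>x. of_real (sqrt (2 * pi)) * (std_normal_density (0 + c * x) *\<^sub>R iexp (t * (0 + c * x))))
      (of_real (sqrt (2 * pi)) * (of_real (exp (- (t^2) / 2)) /\<^sub>R \<bar>c\<bar>))"
    by (intro has_bochner_integral_mult_right) auto
  moreover have "of_real (sqrt (2 * pi)) * (std_normal_density (0 + c * x) *\<^sub>R iexp (t * (0 + c * x)))
      = cis (- (x * y)) * of_real (exp (- s * x\<^sup>2))" for x
  proof -
    have "t * (c * x) = - (x * y)" "sqrt (2 * pi) * std_normal_density (c * x) = exp (- s * x\<^sup>2)"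
      using c by (simp_all add: std_normal_density_def t_def power_mult_distrib)
    then show ?thesis
      by (simp only: scaleR_conv_of_real mult.assoc[symmetric] of_real_mult[symmetric] add_0_left cis_conv_exp)
         (simp only: mult.commute)
  qed
  moreover have "sqrt (2 * pi) * (exp (- (t^2) / 2) / c) = sqrt (pi / s) * exp (- y\<^sup>2 / (4 * s))"
  proof -
    have "sqrt (2 * pi) / c = sqrt (pi / s)" using s by (simp add: c_def real_sqrt_divide[symmetric])
    moreover have "(t^2) / 2 = y\<^sup>2 / (4 * s)" using c by (simp add: t_def power_divide)
    moreover have "sqrt (2 * pi) * (exp (- (t^2) / 2) / c) = (sqrt (2 * pi) / c) * exp (- (t^2 / 2))"
      by simp
    ultimately show ?thesis by simp
  qed
  then have "of_real (sqrt (2 * pi)) * (of_real (exp (- (t^2) / 2)) /\<^sub>R \<bar>c\<bar>)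
      = (of_real (sqrt (pi / s) * exp (- y\<^sup>2 / (4 * s))) :: complex)"
    using c by (simp only: scaleR_conv_of_real of_real_mult[symmetric] divide_inverse abs_of_pos mult.commute)
  ultimately show ?thesis by simp
qed

text \<open>Both \<open>x \<bullet> \<xi>\<close> and \<open>(norm x)\<^sup>2\<close> are sums over
  coordinates, so the integrand and the value are products of their one-dimensional
  counterparts.\<close>

lemma has_bochner_integral_gaussian_fourier:
  fixes \<xi> :: "'a::euclidean_space" and s :: real
  assumes s: "0 < s"
  shows "has_bochner_integral lborel (\<lambda>x. cis (- (x \<bullet> \<xi>)) * of_real (exp (- s * (norm x)\<^sup>2)))
    (of_real ((pi / s) powr (real DIM('a) / 2) * exp (- (norm \<xi>)\<^sup>2 / (4 * s))))"
proof -
  note G = has_bochner_integral_gaussian_fourier_real[OF s]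
  have "has_bochner_integral lborel (\<lambda>x::'a. \<Prod>b\<in>Basis. cis (- ((x \<bullet> b) * (\<xi> \<bullet> b))) * of_real (exp (- s * (x \<bullet> b)\<^sup>2)))
     (\<Prod>b\<in>Basis. \<integral>x. cis (- (x * (\<xi> \<bullet> b))) * of_real (exp (- s * x\<^sup>2)) \<partial>lborel)"
    by (rule has_bochner_integral_lborel_prod) (rule integrable.intros[OF G])
  moreover have "(\<Prod>b\<in>Basis. cis (- ((x \<bullet> b) * (\<xi> \<bullet> b))) * of_real (exp (- s * (x \<bullet> b)\<^sup>2)))
      = cis (- (x \<bullet> \<xi>)) * of_real (exp (- s * (norm x)\<^sup>2))" for x :: 'a
  proof -
    have "(norm x)\<^sup>2 = (\<Sum>b\<in>Basis. (x \<bullet> b)\<^sup>2)"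
      unfolding power2_norm_eq_inner by (subst euclidean_inner) (simp add: power2_eq_square)
    then have "(\<Prod>b\<in>Basis. exp (- s * (x \<bullet> b)\<^sup>2)) = exp (- s * (norm x)\<^sup>2)"
      by (simp only: exp_sum[symmetric] finite_Basis sum_distrib_left)
    moreover have "(\<Prod>b\<in>Basis. cis (- ((x \<bullet> b) * (\<xi> \<bullet> b)))) = cis (- (x \<bullet> \<xi>))"
      unfolding cis_conv_exp by (subst euclidean_inner[of x \<xi>])
        (simp only: exp_sum[symmetric] finite_Basis sum_distrib_left of_real_sum sum_negf of_real_minus mult_minus_right)
    ultimately show ?thesis
      by (simp only: prod.distrib of_real_prod[symmetric])
  qed
  moreover have "(\<Prod>b\<in>Basis. \<integral>x. cis (- (x * (\<xi> \<bullet> b))) * of_real (exp (- s * x\<^sup>2)) \<partial>lborel)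
     = (of_real ((pi / s) powr (real DIM('a) / 2) * exp (- (norm \<xi>)\<^sup>2 / (4 * s))) :: complex)"
  proof -
    have "(norm \<xi>)\<^sup>2 = (\<Sum>b\<in>Basis. (\<xi> \<bullet> b)\<^sup>2)"
      unfolding power2_norm_eq_inner by (subst euclidean_inner) (simp add: power2_eq_square)
    moreover have "sqrt (pi / s) ^ DIM('a) = (pi / s) powr (real DIM('a) / 2)"
    proof -
      have "(pi / s) powr (real DIM('a) / 2) = ((pi / s) powr (1 / 2)) powr real DIM('a)"
        by (simp add: powr_powr)
      also have "\<dots> = sqrt (pi / s) ^ DIM('a)"
        using s by (simp only: powr_half_sqrt powr_realpow real_sqrt_gt_zero divide_pos_pos pi_gt_zero less_imp_le)
      finally show ?thesis by simp
    qed
    moreover have "(\<Prod>b\<in>Basis. exp (- (\<xi> \<bullet> b)\<^sup>2 / (4 * s))) = exp (- (\<Sum>b\<in>Basis. (\<xi> \<bullet> b)\<^sup>2) / (4 * s))"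
      by (simp only: exp_sum[symmetric] finite_Basis sum_divide_distrib sum_negf[symmetric])
    ultimately show ?thesis
      by (simp only: has_bochner_integral_integral_eq[OF G] prod.distrib of_real_prod[symmetric] prod_constant)
  qed
  ultimately show ?thesis by (simp only:)
qed

section \<open>Plancherel's inequality\<close>

lemma borel_measurable_cis [measurable]: "cis \<in> borel_measurable borel"
  by (intro borel_measurable_continuous_onI continuous_intros)

lemma borel_measurable_cnj [measurable]: "cnj \<in> borel_measurable borel"
  by (intro borel_measurable_continuous_onI continuous_intros)

lemma integrable_cis_mult:
  assumes "integrable M f" and [measurable]: "g \<in> borel_measurable M"
  shows "integrable M (\<lambda>x. cis (g x) * f x)"
proof (rule Bochner_Integration.integrable_bound[OF assms(1)])
  have [measurable]: "f \<in> borel_measurable M" using assms(1) by auto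
  show "(\<lambda>x. cis (g x) * f x) \<in> borel_measurable M" by measurable
qed (simp add: norm_mult)

lemma borel_measurable_fourier_integral [measurable]:
  fixes f :: "'a::euclidean_space \<Rightarrow> complex"
  assumes [measurable]: "f \<in> borel_measurable borel"
  shows "fourier_integral f \<in> borel_measurable borel"
  unfolding fourier_integral_def[abs_def]
  by (rule lborel.borel_measurable_lebesgue_integral) measurable

lemma norm_fourier_integral_le: "norm (fourier_integral f \<xi>) \<le> (\<integral>x. norm (f x) \<partial>lborel)"
  unfolding fourier_integral_def
  by (rule order_trans[OF integral_norm_bound]) (simp add: norm_mult)

lemma fourier_integral_diff:
  assumes "integrable lborel f" "integrable lborel g"
  shows "fourier_integral (\<lambda>x. f x - g x) \<xi> = fourier_integral f \<xi> - fourier_integral g \<xi>"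
  unfolding fourier_integral_def using assms
  by (simp add: right_diff_distrib Bochner_Integration.integral_diff integrable_cis_mult)

text \<open>The multiplication formula: the kernel is symmetric in its two variables, and the
  product of two integrable functions is integrable on the product space, so Fubini exchanges the
  roles of \<open>f\<close> and \<open>g\<close>.\<close>

lemma integral_fourier_integral_mult:
  fixes f g :: "'a::euclidean_space \<Rightarrow> complex"
  assumes f: "integrable lborel f" and g: "integrable lborel g"
  shows "(\<integral>u. fourier_integral f u * g u \<partial>lborel) = (\<integral>x. f x * fourier_integral g x \<partial>lborel)"
proof -
  have [measurable]: "f \<in> borel_measurable borel" "g \<in> borel_measurable borel"
    using f g by auto
  let ?F = "\<lambda>x u. cis (- (x \<bullet> u)) * f x * g u"
  have F: "integrable (lborel \<Otimes>\<^sub>M lborel) (\<lambda>(x, u). ?F x u)"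
  proof (rule lborel_pair.Fubini_integrable)
    show "(\<lambda>(x, u). ?F x u) \<in> borel_measurable (lborel \<Otimes>\<^sub>M lborel)" by measurable
    show "integrable lborel (\<lambda>x. \<integral>u. norm (case (x, u) of (x, u) \<Rightarrow> ?F x u) \<partial>lborel)"
      using f by (simp add: norm_mult)
    show "AE x in lborel. integrable lborel (\<lambda>u. case (x, u) of (x, u) \<Rightarrow> ?F x u)"
      using g by (auto intro!: AE_I2 integrable_cis_mult simp: mult.assoc)
  qed
  have "(\<integral>u. fourier_integral f u * g u \<partial>lborel) = (\<integral>u. (\<integral>x. ?F x u \<partial>lborel) \<partial>lborel)"
    unfolding fourier_integral_def by simp
  also have "\<dots> = (\<integral>x. (\<integral>u. ?F x u \<partial>lborel) \<partial>lborel)"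
    by (rule lborel_pair.Fubini_integral[OF F])
  also have "\<dots> = (\<integral>x. f x * fourier_integral g x \<partial>lborel)"
    unfolding fourier_integral_def
    by (intro Bochner_Integration.integral_cong refl)
       (simp add: mult_ac inner_commute flip: integral_mult_right_zero)
  finally show ?thesis .
qed

section \<open>The \<open>L\<^sup>2\<close> bound for Fourier integrals\<close>

text \<open>Fatou's lemma, packaged for an almost everywhere convergent sequence of functions and a
  convergent sequence of bounds.\<close>

lemma nn_integral_le_lim:
  fixes g :: "nat \<Rightarrow> 'a \<Rightarrow> ennreal"
  assumes "\<And>n. g n \<in> borel_measurable M"
    and "AE x in M. (\<lambda>n. g n x) \<longlonglongrightarrow> h x"
    and "\<And>n. (\<integral>\<^sup>+x. g n x \<partial>M) \<le> c n" and "c \<longlonglongrightarrow> c0"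
  shows "(\<integral>\<^sup>+x. h x \<partial>M) \<le> c0"
proof -
  have "(\<integral>\<^sup>+x. h x \<partial>M) = (\<integral>\<^sup>+x. liminf (\<lambda>n. g n x) \<partial>M)"
    by (rule nn_integral_cong_AE) (use assms(2) in eventually_elim, simp add: lim_imp_Liminf)
  also have "\<dots> \<le> liminf (\<lambda>n. \<integral>\<^sup>+x. g n x \<partial>M)"
    by (intro nn_integral_liminf assms)
  also have "\<dots> \<le> liminf c"
    by (intro Liminf_mono always_eventually allI assms)
  also have "\<dots> = c0"
    using assms(4) by (intro lim_imp_Liminf) auto
  finally show ?thesis .
qed

lemma nn_integral_lborel_translate:
  fixes f :: "'a::euclidean_space \<Rightarrow> ennreal"
  assumes [measurable]: "f \<in> borel_measurable borel"
  shows "(\<integral>\<^sup>+y. f (y - x) \<partial>lborel) = (\<integral>\<^sup>+y. f y \<partial>lborel)"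
proof -
  have "(\<integral>\<^sup>+y. f y \<partial>lborel) = (\<integral>\<^sup>+y. f y \<partial>distr lborel borel ((+) (- x)))"
    by (simp only: lborel_distr_plus)
  also have "\<dots> = (\<integral>\<^sup>+y. f (y - x) \<partial>lborel)"
    by (simp add: nn_integral_distr)
  finally show ?thesis by simp
qed

lemma integrable_gaussian: "0 < s \<Longrightarrow> integrable lborel (\<lambda>x::'a::euclidean_space. exp (- s * (norm x)\<^sup>2))"
  using integrable.intros[OF has_bochner_integral_gaussian_fourier[of s "0::'a"]]
  by (simp add: complex_of_real_integrable_eq)

lemma nn_integral_gaussian:
  assumes "0 < s"
  shows "(\<integral>\<^sup>+x. ennreal (exp (- s * (norm (x::'a::euclidean_space))\<^sup>2)) \<partial>lborel)
    = ennreal ((pi / s) powr (real DIM('a) / 2))"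
proof -
  have "complex_of_real (\<integral>x. exp (- s * (norm (x::'a))\<^sup>2) \<partial>lborel) = of_real ((pi / s) powr (real DIM('a) / 2))"
    using has_bochner_integral_integral_eq[OF has_bochner_integral_gaussian_fourier[OF assms, of "0::'a"]]
    by simp
  then have "(\<integral>x. exp (- s * (norm (x::'a))\<^sup>2) \<partial>lborel) = (pi / s) powr (real DIM('a) / 2)"
    by (simp only: of_real_eq_iff)
  then show ?thesis
    using nn_integral_eq_integral[OF integrable_gaussian[OF assms, where 'a='a]] by simp
qed

text \<open>Modulation by \<open>cis (x \<bullet> u)\<close> translates the Fourier transform by
  \<open>x\<close>. As a function of \<open>y - x\<close>, the result serves below as a convolution
  kernel.\<close>

lemma fourier_integral_modulated_gaussian:
  fixes x y :: "'a::euclidean_space"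
  assumes "0 < s"
  shows "fourier_integral (\<lambda>u. cis (x \<bullet> u) * of_real (exp (- s * (norm u)\<^sup>2))) y
    = of_real ((pi / s) powr (real DIM('a) / 2) * exp (- (norm (y - x))\<^sup>2 / (4 * s)))"
proof -
  have eq: "cis (- (u \<bullet> y)) * (cis (x \<bullet> u) * z) = cis (- (u \<bullet> (y - x))) * z" for u :: 'a and z
    by (simp add: mult.assoc[symmetric] cis_mult inner_diff_right inner_commute)
  show ?thesis
    unfolding fourier_integral_def eq
    by (rule has_bochner_integral_integral_eq[OF has_bochner_integral_gaussian_fourier[OF assms]])
qed

text \<open>The Gaussian weight turns the left-hand side into the quadratic form of a convolution kernel
  of total mass \<open>(2 \<pi>)^n\<close>, which Schur's test bounds independently of \<open>s\<close>.\<close>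

lemma nn_integral_gaussian_fourier_integral_le:
  fixes f :: "'a::euclidean_space \<Rightarrow> complex"
  assumes f: "integrable lborel f" and s: "0 < s"
  shows "(\<integral>\<^sup>+u. ennreal (exp (- s * (norm u)\<^sup>2) * (norm (fourier_integral f u))\<^sup>2) \<partial>lborel)
    \<le> ennreal ((2 * pi) ^ DIM('a)) * (\<integral>\<^sup>+x. ennreal ((norm (f x))\<^sup>2) \<partial>lborel)"
proof -
  have [measurable]: "f \<in> borel_measurable borel"
    using f by auto
  define \<gamma> where "\<gamma> z = (pi / s) powr (real DIM('a) / 2) * exp (- (norm z)\<^sup>2 / (4 * s))" for z :: 'a
  have [measurable]: "\<gamma> \<in> borel_measurable borel" unfolding \<gamma>_def[abs_def] by measurable
  have \<gamma>_nonneg: "0 \<le> \<gamma> z" for z by (simp add: \<gamma>_def)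
  have \<gamma>_sym: "\<gamma> (x - y) = \<gamma> (y - x)" for x y by (simp add: \<gamma>_def norm_minus_commute)
  \<comment> \<open>The powers of \<open>s\<close> cancel because
    \<open>(pi / s) * (4 * pi * s) = (2 * pi)\<^sup>2\<close>.\<close>
  have \<gamma>_int: "(\<integral>\<^sup>+y. ennreal (\<gamma> (y - x)) \<partial>lborel) = ennreal ((2 * pi) ^ DIM('a))" for x
  proof -
    have "(\<integral>\<^sup>+y. ennreal (\<gamma> (y - x)) \<partial>lborel) = (\<integral>\<^sup>+y. ennreal (\<gamma> y) \<partial>lborel)"
      by (rule nn_integral_lborel_translate) measurable
    also have "\<dots> = ennreal ((pi / s) powr (real DIM('a) / 2)) * (\<integral>\<^sup>+y. ennreal (exp (- (1 / (4 * s)) * (norm (y::'a))\<^sup>2)) \<partial>lborel)"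
      by (subst nn_integral_cmult[symmetric]) (auto simp: \<gamma>_def ennreal_mult' simp flip: ennreal_mult')
    also have "\<dots> = ennreal ((pi / s) powr (real DIM('a) / 2) * (pi / (1 / (4 * s))) powr (real DIM('a) / 2))"
      using s by (subst nn_integral_gaussian) (auto simp: ennreal_mult)
    also have "(pi / s) powr (real DIM('a) / 2) * (pi / (1 / (4 * s))) powr (real DIM('a) / 2)
        = ((2 * pi)\<^sup>2) powr (real DIM('a) / 2)"
      using s by (subst powr_mult[symmetric]) (auto simp: power2_eq_square mult_ac)
    also have "\<dots> = (2 * pi) ^ DIM('a)"
    proof -
      have "(2 * pi)\<^sup>2 = (2 * pi) powr 2"
        by (rule powr_numeral[symmetric]) simp
      then have "((2 * pi)\<^sup>2) powr (real DIM('a) / 2) = (2 * pi) powr (2 * (real DIM('a) / 2))"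
        by (simp only: powr_powr)
      also have "\<dots> = (2 * pi) powr real DIM('a)" by simp
      also have "\<dots> = (2 * pi) ^ DIM('a)" by (rule powr_realpow) simp
      finally show ?thesis .
    qed
    finally show ?thesis .
  qed
  \<comment> \<open>This makes \<open>fourier_integral f u * g u\<close> the weighted square to be
    integrated. The multiplication formula then moves the transform onto \<open>g\<close>, where it
    becomes the conjugate of the convolution of \<open>f\<close> with
    \<open>\<gamma>\<close>.\<close>
  define g where "g u = of_real (exp (- s * (norm u)\<^sup>2)) * cnj (fourier_integral f u)" for u :: 'a
  have g: "integrable lborel g"
  proof (rule Bochner_Integration.integrable_bound)
    show "integrable lborel (\<lambda>u::'a. (\<integral>x. norm (f x) \<partial>lborel) * exp (- s * (norm u)\<^sup>2))"
      by (intro integrable_mult_right integrable_gaussian[OF s])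
    show "g \<in> borel_measurable lborel" unfolding g_def[abs_def] by simp
    show "AE u in lborel. norm (g u) \<le> norm ((\<integral>x. norm (f x) \<partial>lborel) * exp (- s * (norm u)\<^sup>2))"
      using norm_fourier_integral_le[of f]
      by (auto simp: g_def norm_mult intro!: AE_I2 order_trans[OF _ abs_ge_self])
  qed
  have [measurable]: "g \<in> borel_measurable borel" using g by auto
  have Fg: "norm (fourier_integral g x) \<le> (\<integral>\<^sup>+y. ennreal (norm (f y) * \<gamma> (y - x)) \<partial>lborel)" for x
  proof -
    let ?G = "\<lambda>u. cis (x \<bullet> u) * of_real (exp (- s * (norm u)\<^sup>2))"
    have G: "integrable lborel ?G"
      using integrable_gaussian[OF s] by (intro integrable_cis_mult) (simp_all add: complex_of_real_integrable_eq)
    have "cnj (fourier_integral g x) = (\<integral>u. fourier_integral f u * ?G u \<partial>lborel)"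
      unfolding fourier_integral_def[of g]
      by (subst Bochner_Integration.integral_cnj[symmetric])
         (auto intro!: Bochner_Integration.integral_cong simp: g_def cis_cnj inner_commute mult_ac)
    also have "\<dots> = (\<integral>y. f y * of_real (\<gamma> (y - x)) \<partial>lborel)"
      unfolding integral_fourier_integral_mult[OF f G] fourier_integral_modulated_gaussian[OF s] \<gamma>_def ..
    finally have "norm (fourier_integral g x) = norm (\<integral>y. f y * of_real (\<gamma> (y - x)) \<partial>lborel)"
      by (metis complex_mod_cnj)
    also have "ennreal \<dots> \<le> (\<integral>\<^sup>+y. ennreal (norm (f y * of_real (\<gamma> (y - x)))) \<partial>lborel)"
    proof (rule integral_norm_bound_ennreal)
      show "integrable lborel (\<lambda>y. f y * of_real (\<gamma> (y - x)))"
      proof (rule Bochner_Integration.integrable_bound)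
        show "integrable lborel (\<lambda>y. of_real ((pi / s) powr (real DIM('a) / 2)) * f y)"
          using f by simp
        show "AE y in lborel. norm (f y * of_real (\<gamma> (y - x))) \<le> norm (of_real ((pi / s) powr (real DIM('a) / 2)) * f y)"
          using s by (auto simp: \<gamma>_def norm_mult mult_ac intro!: AE_I2 mult_left_mono)
      qed measurable
    qed
    finally show ?thesis by (simp add: norm_mult \<gamma>_nonneg)
  qed
  have "(\<integral>\<^sup>+u. ennreal (exp (- s * (norm u)\<^sup>2) * (norm (fourier_integral f u))\<^sup>2) \<partial>lborel)
      = (\<integral>\<^sup>+u. ennreal (norm (fourier_integral f u * g u)) \<partial>lborel)"
    by (intro nn_integral_cong) (simp add: g_def norm_mult power2_eq_square)
  also have "\<dots> = ennreal (norm (\<integral>u. fourier_integral f u * g u \<partial>lborel))"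
  \<comment> \<open>The integrand is real and nonnegative, so the norm may be taken outside the
    integral without loss.\<close>
  proof -
    have eq: "fourier_integral f u * g u = of_real (norm (fourier_integral f u * g u))" for u
    proof -
      have "fourier_integral f u * g u = of_real (exp (- s * (norm u)\<^sup>2)) * (fourier_integral f u * cnj (fourier_integral f u))"
        by (simp add: g_def mult_ac)
      also have "\<dots> = of_real (exp (- s * (norm u)\<^sup>2) * (norm (fourier_integral f u))\<^sup>2)"
        by (simp only: complex_norm_square[symmetric] of_real_mult)
      also have "exp (- s * (norm u)\<^sup>2) * (norm (fourier_integral f u))\<^sup>2 = norm (fourier_integral f u * g u)"
        by (simp add: g_def norm_mult power2_eq_square)
      finally show ?thesis .
    qed
    have "integrable lborel (\<lambda>u. fourier_integral f u * g u)"
    proof (rule Bochner_Integration.integrable_bound)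
      show "integrable lborel (\<lambda>u. of_real (\<integral>x. norm (f x) \<partial>lborel) * g u)" using g by simp
      show "AE u in lborel. norm (fourier_integral f u * g u) \<le> norm (of_real (\<integral>x. norm (f x) \<partial>lborel) * g u)"
        using norm_fourier_integral_le[of f]
        by (auto simp: norm_mult intro!: AE_I2 mult_right_mono order_trans[OF _ abs_ge_self])
    qed measurable
    then have "(\<integral>\<^sup>+u. ennreal (norm (fourier_integral f u * g u)) \<partial>lborel)
        = ennreal (\<integral>u. norm (fourier_integral f u * g u) \<partial>lborel)"
      by (intro nn_integral_eq_integral) auto
    moreover have "(\<integral>u. fourier_integral f u * g u \<partial>lborel) = of_real (\<integral>u. norm (fourier_integral f u * g u) \<partial>lborel)"
      by (subst eq) (rule integral_complex_of_real)
    ultimately show ?thesis by (simp del: of_real_mult norm_mult)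
  qed
  also have "(\<integral>u. fourier_integral f u * g u \<partial>lborel) = (\<integral>x. f x * fourier_integral g x \<partial>lborel)"
    by (rule integral_fourier_integral_mult[OF f g])
  also have "ennreal (norm \<dots>) \<le> (\<integral>\<^sup>+x. ennreal (norm (f x * fourier_integral g x)) \<partial>lborel)"
  proof (rule integral_norm_bound_ennreal, rule Bochner_Integration.integrable_bound)
    show "integrable lborel (\<lambda>x. of_real (\<integral>x. norm (g x) \<partial>lborel) * f x)" using f by simp
    show "AE x in lborel. norm (f x * fourier_integral g x) \<le> norm (of_real (\<integral>x. norm (g x) \<partial>lborel) * f x)"
      using norm_fourier_integral_le[of g]
      by (auto simp: norm_mult mult.commute intro!: AE_I2 mult_left_mono order_trans[OF _ abs_ge_self])
  qed measurable
  \<comment> \<open>Schur's test: the product \<open>norm (f x) * norm (f y)\<close> is split by the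
    inequality between geometric and arithmetic means.\<close>
  also have "\<dots> \<le> (\<integral>\<^sup>+x. \<integral>\<^sup>+y. ennreal ((norm (f x))\<^sup>2 / 2 * \<gamma> (y - x)) + ennreal ((norm (f y))\<^sup>2 / 2 * \<gamma> (y - x)) \<partial>lborel \<partial>lborel)"
  proof (rule nn_integral_mono)
    fix x
    have "ennreal (norm (f x * fourier_integral g x)) \<le> ennreal (norm (f x)) * (\<integral>\<^sup>+y. ennreal (norm (f y) * \<gamma> (y - x)) \<partial>lborel)"
      using Fg by (simp add: norm_mult ennreal_mult mult_left_mono)
    also have "\<dots> = (\<integral>\<^sup>+y. ennreal (norm (f x) * norm (f y) * \<gamma> (y - x)) \<partial>lborel)"
      by (subst nn_integral_cmult[symmetric]) (auto simp: mult.assoc \<gamma>_nonneg simp flip: ennreal_mult)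
    also have "\<dots> \<le> (\<integral>\<^sup>+y. ennreal ((norm (f x))\<^sup>2 / 2 * \<gamma> (y - x)) + ennreal ((norm (f y))\<^sup>2 / 2 * \<gamma> (y - x)) \<partial>lborel)"
    proof (rule nn_integral_mono)
      fix y
      have "norm (f x) * norm (f y) \<le> (norm (f x))\<^sup>2 / 2 + (norm (f y))\<^sup>2 / 2"
        using sum_squares_bound[of "norm (f x)" "norm (f y)"] by simp
      then have "norm (f x) * norm (f y) * \<gamma> (y - x) \<le> ((norm (f x))\<^sup>2 / 2 + (norm (f y))\<^sup>2 / 2) * \<gamma> (y - x)"
        by (rule mult_right_mono) (rule \<gamma>_nonneg)
      then have "ennreal (norm (f x) * norm (f y) * \<gamma> (y - x))
          \<le> ennreal ((norm (f x))\<^sup>2 / 2 * \<gamma> (y - x) + (norm (f y))\<^sup>2 / 2 * \<gamma> (y - x))"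
        by (intro ennreal_leI) (simp only: distrib_right)
      also have "\<dots> = ennreal ((norm (f x))\<^sup>2 / 2 * \<gamma> (y - x)) + ennreal ((norm (f y))\<^sup>2 / 2 * \<gamma> (y - x))"
        by (rule ennreal_plus) (auto simp: \<gamma>_nonneg)
      finally show "ennreal (norm (f x) * norm (f y) * \<gamma> (y - x)) \<le> \<dots>" .
    qed
    finally show "ennreal (norm (f x * fourier_integral g x)) \<le> \<dots>" .
  qed
  also have "\<dots> = (\<integral>\<^sup>+x. \<integral>\<^sup>+y. ennreal ((norm (f x))\<^sup>2 / 2 * \<gamma> (y - x)) \<partial>lborel \<partial>lborel)
      + (\<integral>\<^sup>+x. \<integral>\<^sup>+y. ennreal ((norm (f y))\<^sup>2 / 2 * \<gamma> (y - x)) \<partial>lborel \<partial>lborel)"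
    by (subst nn_integral_add[symmetric])
       (auto intro!: nn_integral_cong nn_integral_add)
  \<comment> \<open>Exchanging the variables and using the symmetry of \<open>\<gamma>\<close> shows
    that the two halves are equal.\<close>
  also have "(\<integral>\<^sup>+x. \<integral>\<^sup>+y. ennreal ((norm (f y))\<^sup>2 / 2 * \<gamma> (y - x)) \<partial>lborel \<partial>lborel)
      = (\<integral>\<^sup>+x. \<integral>\<^sup>+y. ennreal ((norm (f x))\<^sup>2 / 2 * \<gamma> (y - x)) \<partial>lborel \<partial>lborel)"
    by (subst lborel_pair.Fubini') (auto simp: \<gamma>_sym)
  also have "(\<integral>\<^sup>+x. \<integral>\<^sup>+y. ennreal ((norm (f x))\<^sup>2 / 2 * \<gamma> (y - x)) \<partial>lborel \<partial>lborel)
      = (\<integral>\<^sup>+x. ennreal ((norm (f x))\<^sup>2 / 2) * ennreal ((2 * pi) ^ DIM('a)) \<partial>lborel)"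
  proof (rule nn_integral_cong)
    fix x
    have "(\<integral>\<^sup>+y. ennreal ((norm (f x))\<^sup>2 / 2 * \<gamma> (y - x)) \<partial>lborel)
        = (\<integral>\<^sup>+y. ennreal ((norm (f x))\<^sup>2 / 2) * ennreal (\<gamma> (y - x)) \<partial>lborel)"
      by (intro nn_integral_cong ennreal_mult) (auto simp: \<gamma>_nonneg)
    also have "\<dots> = ennreal ((norm (f x))\<^sup>2 / 2) * ennreal ((2 * pi) ^ DIM('a))"
      by (subst nn_integral_cmult) (auto simp: \<gamma>_int)
    finally show "(\<integral>\<^sup>+y. ennreal ((norm (f x))\<^sup>2 / 2 * \<gamma> (y - x)) \<partial>lborel) = \<dots>" .
  qed
  also have "\<dots> + \<dots> = (\<integral>\<^sup>+x. ennreal ((2 * pi) ^ DIM('a)) * ennreal ((norm (f x))\<^sup>2) \<partial>lborel)"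
    by (subst nn_integral_add[symmetric])
       (auto intro!: nn_integral_cong simp: mult.commute simp flip: ennreal_mult' ennreal_plus)
  also have "\<dots> = ennreal ((2 * pi) ^ DIM('a)) * (\<integral>\<^sup>+x. ennreal ((norm (f x))\<^sup>2) \<partial>lborel)"
    by (rule nn_integral_cmult) measurable
  finally show ?thesis .
qed

text \<open>The bound for the Gaussian weight does not depend on \<open>s\<close>. Taking
  \<open>s = 1 / (n + 1)\<close>, the weight tends to \<open>1\<close> and Fatou's lemma removes it.
  The right-hand side is allowed to be infinite.\<close>

lemma nn_integral_fourier_integral_le:
  fixes f :: "'a::euclidean_space \<Rightarrow> complex"
  assumes f: "integrable lborel f"
  shows "(\<integral>\<^sup>+u. ennreal ((norm (fourier_integral f u))\<^sup>2) \<partial>lborel)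
    \<le> ennreal ((2 * pi) ^ DIM('a)) * (\<integral>\<^sup>+x. ennreal ((norm (f x))\<^sup>2) \<partial>lborel)"
proof (rule nn_integral_le_lim[where
      g="\<lambda>n u. ennreal (exp (- (1 / real (Suc n)) * (norm u)\<^sup>2) * (norm (fourier_integral f u))\<^sup>2)"])
  have [measurable]: "f \<in> borel_measurable borel"
    using f by auto
  show "(\<lambda>u. ennreal (exp (- (1 / real (Suc n)) * (norm u)\<^sup>2) * (norm (fourier_integral f u))\<^sup>2)) \<in> borel_measurable lborel" for n
    by measurable
  have "(\<lambda>n. exp (- (1 / real (Suc n)) * (norm u)\<^sup>2) * (norm (fourier_integral f u))\<^sup>2)
      \<longlonglongrightarrow> exp (- 0 * (norm u)\<^sup>2) * (norm (fourier_integral f u))\<^sup>2" for u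
    by (intro tendsto_intros) (rule LIMSEQ_Suc[OF lim_1_over_n])
  then show "AE u in lborel. (\<lambda>n. ennreal (exp (- (1 / real (Suc n)) * (norm u)\<^sup>2) * (norm (fourier_integral f u))\<^sup>2))
      \<longlonglongrightarrow> ennreal ((norm (fourier_integral f u))\<^sup>2)"
    by (intro AE_I2 tendsto_ennrealI) simp
  show "(\<integral>\<^sup>+u. ennreal (exp (- (1 / real (Suc n)) * (norm u)\<^sup>2) * (norm (fourier_integral f u))\<^sup>2) \<partial>lborel)
      \<le> ennreal ((2 * pi) ^ DIM('a)) * (\<integral>\<^sup>+x. ennreal ((norm (f x))\<^sup>2) \<partial>lborel)" for n
    by (rule nn_integral_gaussian_fourier_integral_le[OF f]) simp
qed simp

section \<open>Uniqueness of the \<open>L\<^sup>2\<close> Fourier transform\<close>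

text \<open>Two limits of the same truncated transforms are at distance \<open>0\<close>, by the
  triangle inequality in the squared form
  \<open>(p + q)\<^sup>2 \<le> 2 * p\<^sup>2 + 2 * q\<^sup>2\<close>.\<close>

lemma is_fourier_L2_unique:
  assumes [measurable]: "f \<in> borel_measurable borel"
    and g: "is_fourier_L2 f g" and h: "is_fourier_L2 f h"
  shows "AE u in lborel. g u = h u"
proof -
  let ?F = "\<lambda>R. fourier_integral (\<lambda>x. indicator (cball 0 R) x * f x)"
  let ?d = "\<lambda>g R. \<integral>\<^sup>+\<xi>. ennreal ((norm (g \<xi> - ?F R \<xi>))\<^sup>2) \<partial>lborel"
  have [measurable]: "g \<in> borel_measurable borel" "h \<in> borel_measurable borel"
    using g h by (auto simp: is_fourier_L2_def L2_def)
  have [measurable]: "?F R \<in> borel_measurable borel" for R :: real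
    by (intro borel_measurable_fourier_integral borel_measurable_times borel_measurable_indicator) auto
  have le: "(\<integral>\<^sup>+\<xi>. ennreal ((norm (g \<xi> - h \<xi>))\<^sup>2) \<partial>lborel) \<le> 2 * ?d g R + 2 * ?d h R" for R :: real
  proof -
    have "(\<integral>\<^sup>+\<xi>. ennreal ((norm (g \<xi> - h \<xi>))\<^sup>2) \<partial>lborel)
        \<le> (\<integral>\<^sup>+\<xi>. 2 * ennreal ((norm (g \<xi> - ?F R \<xi>))\<^sup>2) + 2 * ennreal ((norm (h \<xi> - ?F R \<xi>))\<^sup>2) \<partial>lborel)"
    proof (rule nn_integral_mono)
      fix \<xi>
      have "norm (g \<xi> - h \<xi>) \<le> norm (g \<xi> - ?F R \<xi>) + norm (h \<xi> - ?F R \<xi>)"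
        using norm_triangle_ineq4[of "g \<xi> - ?F R \<xi>" "h \<xi> - ?F R \<xi>"] by simp
      then have "(norm (g \<xi> - h \<xi>))\<^sup>2 \<le> (norm (g \<xi> - ?F R \<xi>) + norm (h \<xi> - ?F R \<xi>))\<^sup>2"
        by (rule power_mono) simp
      also have "\<dots> \<le> 2 * (norm (g \<xi> - ?F R \<xi>))\<^sup>2 + 2 * (norm (h \<xi> - ?F R \<xi>))\<^sup>2"
        using sum_squares_bound[of "norm (g \<xi> - ?F R \<xi>)" "norm (h \<xi> - ?F R \<xi>)"]
        by (simp add: power2_sum)
      finally have "ennreal ((norm (g \<xi> - h \<xi>))\<^sup>2) \<le> ennreal (2 * (norm (g \<xi> - ?F R \<xi>))\<^sup>2 + 2 * (norm (h \<xi> - ?F R \<xi>))\<^sup>2)"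
        by (rule ennreal_leI)
      then show "ennreal ((norm (g \<xi> - h \<xi>))\<^sup>2) \<le> 2 * ennreal ((norm (g \<xi> - ?F R \<xi>))\<^sup>2) + 2 * ennreal ((norm (h \<xi> - ?F R \<xi>))\<^sup>2)"
        by (simp add: ennreal_mult')
    qed
    also have "\<dots> = 2 * ?d g R + 2 * ?d h R"
      by (subst nn_integral_add) (auto simp: nn_integral_cmult)
    finally show ?thesis .
  qed
  have "((\<lambda>R. 2 * ?d g R + 2 * ?d h R) \<longlongrightarrow> 2 * 0 + 2 * 0) at_top"
    using g h unfolding is_fourier_L2_def
    by (intro tendsto_add ennreal_tendsto_cmult) auto
  then have "(\<integral>\<^sup>+\<xi>. ennreal ((norm (g \<xi> - h \<xi>))\<^sup>2) \<partial>lborel) \<le> 2 * 0 + 2 * 0"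
    by (rule tendsto_lowerbound) (auto simp: le)
  then have "AE \<xi> in lborel. ennreal ((norm (g \<xi> - h \<xi>))\<^sup>2) = 0"
    by (subst (asm) mult_zero_right, subst (asm) mult_zero_right) (simp add: nn_integral_0_iff_AE)
  then show ?thesis by eventually_elim simp
qed

section \<open>Gamma integrals\<close>

text \<open>Euler's integral for \<open>Gamma b\<close> under the substitution of
  \<open>x * t\<close> for \<open>t\<close>. It represents a negative power as a mixture of
  exponentials; with \<open>x = (norm \<xi>)\<^sup>2\<close> these are Gaussians.\<close>

lemma nn_integral_Gamma_scaled:
  fixes b x :: real
  assumes b: "0 < b" and x: "0 < x"
  shows "(\<integral>\<^sup>+t. ennreal (indicator {0<..} t * (t powr (b - 1) * exp (- x * t))) \<partial>lborel)
    = ennreal (Gamma b * x powr (- b))"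
proof -
  let ?I = "\<integral>\<^sup>+t. ennreal (indicator {0<..} t * (t powr (b - 1) * exp (- x * t))) \<partial>lborel"
  have "ennreal (Gamma b) = (\<integral>\<^sup>+t. ennreal (indicator {0..} t * t powr (b - 1) / exp t) \<partial>lborel)"
    by (rule Gamma_conv_nn_integral_real[OF b])
  also have "\<dots> = ennreal \<bar>x\<bar> * (\<integral>\<^sup>+t. ennreal (indicator {0..} (0 + x * t) * (0 + x * t) powr (b - 1) / exp (0 + x * t)) \<partial>lborel)"
    using x by (intro nn_integral_real_affine) auto
  also have "(\<integral>\<^sup>+t. ennreal (indicator {0..} (0 + x * t) * (0 + x * t) powr (b - 1) / exp (0 + x * t)) \<partial>lborel)
      = (\<integral>\<^sup>+t. ennreal (x powr (b - 1)) * ennreal (indicator {0<..} t * (t powr (b - 1) * exp (- x * t))) \<partial>lborel)"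
  proof (rule nn_integral_cong)
    fix t :: real
    have "indicator {0..} (0 + x * t) * (0 + x * t) powr (b - 1) / exp (0 + x * t)
        = x powr (b - 1) * (indicator {0<..} t * (t powr (b - 1) * exp (- x * t)))"
      using x by (cases "t = 0")
        (auto simp: indicator_def powr_mult exp_minus field_simps zero_le_mult_iff)
    then show "ennreal (indicator {0..} (0 + x * t) * (0 + x * t) powr (b - 1) / exp (0 + x * t))
        = ennreal (x powr (b - 1)) * ennreal (indicator {0<..} t * (t powr (b - 1) * exp (- x * t)))"
      by (simp add: ennreal_mult')
  qed
  also have "\<dots> = ennreal (x powr (b - 1)) * ?I"
    by (rule nn_integral_cmult) measurable
  finally have "ennreal (Gamma b) = ennreal \<bar>x\<bar> * (ennreal (x powr (b - 1)) * ?I)" .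
  also have "\<dots> = ennreal (x powr b) * ?I"
    using x by (simp add: mult.assoc[symmetric] powr_mult_base flip: ennreal_mult')
  \<comment> \<open>Multiplication by the reciprocal power replaces a division, as the integral is
    so far only an extended real.\<close>
  finally have "ennreal (x powr (- b)) * ennreal (Gamma b) = ennreal (x powr (- b)) * ennreal (x powr b) * ?I"
    by (simp add: mult.assoc)
  also have "ennreal (x powr (- b)) * ennreal (x powr b) = 1"
    using x by (simp flip: ennreal_mult' powr_add)
  finally show ?thesis
    using b by (simp add: mult.commute flip: ennreal_mult')
qed

text \<open>The substitution \<open>t = 1 / s\<close> in the scaled Gamma integral: the Jacobian
  \<open>1 / s\<^sup>2\<close> turns \<open>t powr (c - 1)\<close> into
  \<open>s powr (- c - 1)\<close>.\<close>

lemma nn_integral_Gamma_inverse: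
  fixes c x :: real
  assumes c: "0 < c" and x: "0 < x"
  shows "(\<integral>\<^sup>+s. ennreal (indicator {0<..} s * (s powr (- c - 1) * exp (- x / s))) \<partial>lborel)
    = ennreal (Gamma c * x powr (- c))"
proof -
  define f where "f t = t powr (c - 1) * exp (- x * t)" for t :: real
  let ?r = "Gamma c * x powr (- c)"
  \<comment> \<open>The change of variables is carried out for absolutely integrable functions on
    \<open>{0<..}\<close>, hence the passage to \<open>has_integral\<close> and, at the end, back to
    the nonnegative integral.\<close>
  have "((\<lambda>t. indicator {0<..} t * f t) has_integral ?r) UNIV"
    using nn_integral_Gamma_scaled[OF c x] c
    by (intro nn_integral_has_integral) (auto simp: f_def Gamma_real_nonneg)
  moreover have "(\<lambda>t. indicator {0<..} t * f t) = (\<lambda>t. if t \<in> {0<..} then f t else 0)"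
    by (auto simp: indicator_def)
  ultimately have f: "(f has_integral ?r) {0<..}"
    by (simp only: has_integral_restrict_UNIV)
  have "f absolutely_integrable_on {0<..}"
    using f by (intro nonnegative_absolutely_integrable_1) (auto simp: f_def)
  moreover have "inverse ` {0<..} = ({0<..} :: real set)"
    by (auto simp: image_iff intro!: bexI[of _ "inverse _"])
  ultimately have "f absolutely_integrable_on (inverse ` {0<..}) \<and> integral (inverse ` {0<..}) f = ?r"
    using f by (simp add: integral_unique)
  moreover have "(inverse has_field_derivative - (inverse s ^ Suc (Suc 0))) (at s within {0<..})"
    if "s \<in> {0<..}" for s :: real
    using that by (intro DERIV_inverse) auto
  moreover have "inj_on inverse ({0<..} :: real set)" by (auto simp: inj_on_def)
  ultimately have *: "(\<lambda>s. \<bar>- (inverse s ^ Suc (Suc 0))\<bar> * f (inverse s)) absolutely_integrable_on {0<..} \<and>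
      integral {0<..} (\<lambda>s. \<bar>- (inverse s ^ Suc (Suc 0))\<bar> * f (inverse s)) = ?r"
    by (subst has_absolute_integral_change_of_variables_1') auto
  have "((\<lambda>s. \<bar>- (inverse s ^ Suc (Suc 0))\<bar> * f (inverse s)) has_integral ?r) {0<..}"
    using * by (metis set_lebesgue_integral_eq_integral(1) integrable_integral)
  then have "(\<integral>\<^sup>+s. ennreal (indicator {0<..} s * (\<bar>- (inverse s ^ Suc (Suc 0))\<bar> * f (inverse s))) \<partial>lborel) = ennreal ?r"
    by (intro nn_integral_has_integral_lebesgue) (auto simp: f_def)
  moreover have "\<bar>- (inverse s ^ Suc (Suc 0))\<bar> * f (inverse s) = s powr (- c - 1) * exp (- x / s)" if "0 < s" for s
  proof -
    have "inverse s ^ Suc (Suc 0) = s powr (-2)"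
      using that by (simp add: powr_minus powr_numeral power2_eq_square)
    moreover have "inverse s powr (c - 1) = s powr (1 - c)"
      using that by (simp add: powr_minus[symmetric] inverse_powr)
    moreover have "s powr (-2) * s powr (1 - c) = s powr (- c - 1)"
      unfolding powr_add[symmetric] by (rule arg_cong) simp
    ultimately show ?thesis
      using that by (simp add: f_def divide_inverse mult.assoc[symmetric])
  qed
  then have "indicator {0<..} s * (\<bar>- (inverse s ^ Suc (Suc 0))\<bar> * f (inverse s))
      = indicator {0<..} s * (s powr (- c - 1) * exp (- x / s))" for s
    by (cases "0 < s") auto
  ultimately show ?thesis by (simp only:)
qed

text \<open>The difference of exponentials is the integral of \<open>exp (- x / s) / s\<close> over
  \<open>x\<close> in \<open>{p..q}\<close>. After Tonelli, the integral over \<open>s\<close> is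
  the inverse Gamma integral. The case \<open>p = 0\<close> is included for the square-integrability
  of the harmonizable kernel.\<close>

lemma nn_integral_powr_mult_exp_diff:
  fixes c p q :: real
  assumes c: "0 < c" and p: "0 \<le> p" and q: "p \<le> q"
  shows "(\<integral>\<^sup>+s. ennreal (indicator {0<..} s * (s powr (- c) * (exp (- p / s) - exp (- q / s)))) \<partial>lborel)
    = ennreal (Gamma c) * (\<integral>\<^sup>+x. ennreal (indicator {p..q} x * x powr (- c)) \<partial>lborel)"
proof -
  let ?F = "\<lambda>s x. ennreal (indicator {p..q} x * (indicator {0<..} s * (s powr (- c - 1) * exp (- x / s))))"
  have "(\<integral>\<^sup>+s. ennreal (indicator {0<..} s * (s powr (- c) * (exp (- p / s) - exp (- q / s)))) \<partial>lborel)
      = (\<integral>\<^sup>+s. (\<integral>\<^sup>+x. ?F s x \<partial>lborel) \<partial>lborel)"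
  proof (rule nn_integral_cong)
    fix s :: real
    show "ennreal (indicator {0<..} s * (s powr (- c) * (exp (- p / s) - exp (- q / s)))) = (\<integral>\<^sup>+x. ?F s x \<partial>lborel)"
    proof (cases "0 < s")
      case True
      have "(\<integral>\<^sup>+x. ennreal (exp (- x / s) / s) * indicator {p..q} x \<partial>lborel) = ennreal (- exp (- q / s) - (- exp (- p / s)))"
        using True q by (intro nn_integral_FTC_Icc) (auto intro!: derivative_eq_intros)
      then have "ennreal (s powr (- c)) * (\<integral>\<^sup>+x. ennreal (exp (- x / s) / s) * indicator {p..q} x \<partial>lborel)
          = ennreal (s powr (- c) * (exp (- p / s) - exp (- q / s)))"
        by (simp add: ennreal_mult')
      moreover have "ennreal (s powr (- c)) * (\<integral>\<^sup>+x. ennreal (exp (- x / s) / s) * indicator {p..q} x \<partial>lborel)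
          = (\<integral>\<^sup>+x. ennreal (s powr (- c)) * (ennreal (exp (- x / s) / s) * indicator {p..q} x) \<partial>lborel)"
        by (rule nn_integral_cmult[symmetric]) measurable
      moreover have "ennreal (s powr (- c)) * (ennreal (exp (- x / s) / s) * indicator {p..q} x) = ?F s x" for x
        using True by (auto simp: indicator_def powr_diff simp flip: ennreal_mult')
      ultimately show ?thesis using True by simp
    qed simp
  qed
  also have "\<dots> = (\<integral>\<^sup>+x. (\<integral>\<^sup>+s. ?F s x \<partial>lborel) \<partial>lborel)"
    by (rule lborel_pair.Fubini') measurable
  also have "\<dots> = (\<integral>\<^sup>+x. ennreal (Gamma c) * ennreal (indicator {p..q} x * x powr (- c)) \<partial>lborel)"
  proof (rule nn_integral_cong_AE)
    \<comment> \<open>The point \<open>x = 0\<close>, which lies in the interval when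
      \<open>p = 0\<close>, is discarded because the inner integral is evaluated only for positive
      \<open>x\<close>.\<close>
    show "AE x in lborel. (\<integral>\<^sup>+s. ?F s x \<partial>lborel) = ennreal (Gamma c) * ennreal (indicator {p..q} x * x powr (- c))"
      using AE_lborel_singleton[of "0::real"]
    proof eventually_elim
      case (elim x)
      show ?case
      proof (cases "x \<in> {p..q}")
        case True
        then have "0 < x" using p elim by auto
        then show ?thesis
          using nn_integral_Gamma_inverse[OF c] True c by (simp add: ennreal_mult')
      qed simp
    qed
  qed
  also have "\<dots> = ennreal (Gamma c) * (\<integral>\<^sup>+x. ennreal (indicator {p..q} x * x powr (- c)) \<partial>lborel)"
    by (rule nn_integral_cmult) measurable
  finally show ?thesis .
qed

text \<open>For \<open>p \<le> q\<close> the remaining integral of \<open>x powr (- c)\<close> over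
  \<open>{p..q}\<close> is elementary: \<open>p > 0\<close> keeps it finite, and
  \<open>c \<noteq> 1\<close> keeps the antiderivative a power. The other order follows by
  antisymmetry.\<close>

lemma has_bochner_integral_powr_mult_exp_diff:
  fixes c p q :: real
  assumes c: "0 < c" "c \<noteq> 1" and p: "0 < p" and q: "0 < q"
  shows "has_bochner_integral lborel
    (\<lambda>s. indicator {0<..} s * (s powr (- c) * (exp (- p / s) - exp (- q / s))))
    (Gamma c / (c - 1) * (p powr (1 - c) - q powr (1 - c)))"
proof -
  have *: "has_bochner_integral lborel
    (\<lambda>s. indicator {0<..} s * (s powr (- c) * (exp (- p / s) - exp (- q / s))))
    (Gamma c / (c - 1) * (p powr (1 - c) - q powr (1 - c)))"
    if p: "0 < p" and q: "p \<le> q" for p q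
  proof (rule has_bochner_integral_nn_integral)
    have "(\<integral>\<^sup>+x. ennreal (x powr (- c)) * indicator {p..q} x \<partial>lborel)
        = ennreal (q powr (1 - c) / (1 - c) - p powr (1 - c) / (1 - c))"
      using p q c by (intro nn_integral_FTC_Icc) (auto intro!: derivative_eq_intros)
    moreover have "ennreal (x powr (- c)) * indicator {p..q} x = ennreal (indicator {p..q} x * x powr (- c))" for x
      by (auto simp: indicator_def)
    moreover have "q powr (1 - c) / (1 - c) - p powr (1 - c) / (1 - c) = (p powr (1 - c) - q powr (1 - c)) / (c - 1)"
      by (metis diff_divide_distrib minus_diff_eq minus_divide_divide)
    ultimately show "(\<integral>\<^sup>+s. ennreal (indicator {0<..} s * (s powr (- c) * (exp (- p / s) - exp (- q / s)))) \<partial>lborel)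
        = ennreal (Gamma c / (c - 1) * (p powr (1 - c) - q powr (1 - c)))"
      using nn_integral_powr_mult_exp_diff[of c p q] p q c
      by (simp add: Gamma_real_nonneg flip: ennreal_mult')
    \<comment> \<open>\<open>c - 1\<close> and the difference of powers have matching signs on
      either side of \<open>c = 1\<close>.\<close>
    show "0 \<le> Gamma c / (c - 1) * (p powr (1 - c) - q powr (1 - c))"
    proof (cases "c < 1")
      case True
      then have "p powr (1 - c) \<le> q powr (1 - c)" using p q by (intro powr_mono2) auto
      then show ?thesis using True c Gamma_real_pos[of c]
        by (intro mult_nonpos_nonpos) (auto simp: divide_le_0_iff)
    next
      case False
      then have "q powr (1 - c) \<le> p powr (1 - c)" using p q by (intro powr_mono2') auto
      then show ?thesis using False c Gamma_real_pos[of c] by auto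
    qed
    show "AE s in lborel. 0 \<le> indicator {0<..} s * (s powr (- c) * (exp (- p / s) - exp (- q / s)))"
      using q by (intro AE_I2) (auto simp: indicator_def divide_right_mono)
  qed measurable
  show ?thesis
  proof (cases "p \<le> q")
    case False
    then have "has_bochner_integral lborel
      (\<lambda>s. - (indicator {0<..} s * (s powr (- c) * (exp (- q / s) - exp (- p / s)))))
      (- (Gamma c / (c - 1) * (q powr (1 - c) - p powr (1 - c))))"
      using q by (intro has_bochner_integral_minus *) auto
    then show ?thesis by (simp add: algebra_simps)
  qed (use p * in auto)
qed

section \<open>Identifying \<open>L\<^sup>2\<close> Fourier transforms by pointwise limits\<close>

lemma norm_diff_power2_le:
  fixes a b :: "'a::real_normed_vector"
  assumes "norm a \<le> r" "norm b \<le> r"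
  shows "(norm (a - b))\<^sup>2 \<le> 4 * r\<^sup>2"
proof -
  have "norm (a - b) \<le> 2 * r"
    using norm_triangle_ineq4[of a b] assms by simp
  then have "(norm (a - b))\<^sup>2 \<le> (2 * r)\<^sup>2" by (rule power_mono) simp
  then show ?thesis by (simp add: power_mult_distrib)
qed

text \<open>Balls have finite measure and \<open>norm (f x) \<le> 1 + (norm (f x))\<^sup>2\<close>.
  Thus the truncations in \<open>is_fourier_L2\<close> have genuine Fourier integrals.\<close>

lemma integrable_indicator_cball_mult:
  fixes f :: "'a::euclidean_space \<Rightarrow> complex"
  assumes [measurable]: "f \<in> borel_measurable borel"
    and L2: "integrable lborel (\<lambda>x. (norm (f x))\<^sup>2)"
  shows "integrable lborel (\<lambda>x. indicator (cball 0 R) x * f x)"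
proof (rule Bochner_Integration.integrable_bound)
  show "integrable lborel (\<lambda>x. indicat_real (cball 0 R) x + (norm (f x))\<^sup>2)"
    using L2 emeasure_lborel_cball_finite[of 0 R]
    by (intro Bochner_Integration.integrable_add integrable_real_indicator) auto
  show "(\<lambda>x. indicator (cball 0 R) x * f x) \<in> borel_measurable lborel"
    by (intro borel_measurable_times borel_measurable_indicator) auto
  have "norm (f x) \<le> 1 + (norm (f x))\<^sup>2" for x
    using sum_squares_bound[of 1 "norm (f x)"] norm_ge_zero[of "f x"] by (simp del: norm_ge_zero)
  then show "AE x in lborel. norm (indicator (cball 0 R) x * f x) \<le> norm (indicat_real (cball 0 R) x + (norm (f x))\<^sup>2)"
    by (intro AE_I2) (auto simp: indicator_def)
qed

text \<open>By Plancherel's inequality, \<open>L\<^sup>2\<close> approximation of \<open>f\<close> by integrable functions carries over to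
  the Fourier side, where Fatou's lemma replaces the unknown \<open>L\<^sup>2\<close> limit by a pointwise one.\<close>

lemma is_fourier_L2_pointwise_limit:
  fixes f g :: "'a::euclidean_space \<Rightarrow> complex" and h :: "nat \<Rightarrow> 'a \<Rightarrow> complex"
  assumes f: "f \<in> L2" and h: "\<And>n. integrable lborel (h n)" and [measurable]: "g \<in> borel_measurable borel"
    and le: "AE x in lborel. \<forall>n. norm (h n x) \<le> norm (f x)"
    and lim: "AE x in lborel. (\<lambda>n. h n x) \<longlonglongrightarrow> f x"
    and Flim: "AE u in lborel. (\<lambda>n. fourier_integral (h n) u) \<longlonglongrightarrow> g u"
  shows "is_fourier_L2 f g"
proof -
  have [measurable]: "f \<in> borel_measurable borel" and f2: "integrable lborel (\<lambda>x. (norm (f x))\<^sup>2)"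
    using f by (auto simp: L2_def)
  have [measurable]: "h n \<in> borel_measurable borel" for n
    using h[of n] by auto
  have fin: "(\<integral>\<^sup>+x. ennreal ((norm (f x))\<^sup>2) \<partial>lborel) < \<infinity>"
    using f2 by (simp add: integrable_iff_bounded)
  have fin4: "(\<integral>\<^sup>+x. ennreal (4 * (norm (f x))\<^sup>2) \<partial>lborel) < \<infinity>"
    using fin by (simp add: ennreal_mult' nn_integral_cmult ennreal_mult_less_top)
  define C where "C = ennreal ((2 * pi) ^ DIM('a))"
  let ?f = "\<lambda>R x. indicator (cball 0 R) x * f x"
  have fR [measurable]: "?f R \<in> borel_measurable borel" for R
    by (intro borel_measurable_times borel_measurable_indicator) auto
  have FfR [measurable]: "fourier_integral (?f R) \<in> borel_measurable borel" for R
    by (intro borel_measurable_fourier_integral fR)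
  \<comment> \<open>Plancherel's inequality bounds the transforms of all \<open>h n\<close> by the
    \<open>L\<^sup>2\<close> norm of \<open>f\<close>, and Fatou's lemma passes this bound to
    \<open>g\<close>.\<close>
  have "(\<integral>\<^sup>+u. ennreal ((norm (g u))\<^sup>2) \<partial>lborel) \<le> C * (\<integral>\<^sup>+x. ennreal ((norm (f x))\<^sup>2) \<partial>lborel)"
  proof (rule nn_integral_le_lim[where g="\<lambda>n u. ennreal ((norm (fourier_integral (h n) u))\<^sup>2)"])
    show "AE u in lborel. (\<lambda>n. ennreal ((norm (fourier_integral (h n) u))\<^sup>2)) \<longlonglongrightarrow> ennreal ((norm (g u))\<^sup>2)"
      using Flim by eventually_elim (intro tendsto_intros)
    show "(\<integral>\<^sup>+u. ennreal ((norm (fourier_integral (h n) u))\<^sup>2) \<partial>lborel) \<le> C * (\<integral>\<^sup>+x. ennreal ((norm (f x))\<^sup>2) \<partial>lborel)" for n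
    proof -
      have "AE x in lborel. ennreal ((norm (h n x))\<^sup>2) \<le> ennreal ((norm (f x))\<^sup>2)"
        using le by eventually_elim (auto intro!: ennreal_leI power_mono)
      then show ?thesis
        unfolding C_def
        by (intro order_trans[OF nn_integral_fourier_integral_le[OF h]] mult_left_mono nn_integral_mono_AE) auto
    qed
  qed auto
  also have "\<dots> < \<infinity>"
    using fin by (simp add: C_def ennreal_mult_less_top)
  finally have "g \<in> L2"
    by (simp add: L2_def integrable_iff_bounded)
  moreover have "((\<lambda>R. \<integral>\<^sup>+u. ennreal ((norm (g u - fourier_integral (?f R) u))\<^sup>2) \<partial>lborel) \<longlongrightarrow> 0) at_top"
  proof (rule tendsto_sandwich[where f="\<lambda>_. 0"
        and h="\<lambda>R. C * (\<integral>\<^sup>+x. ennreal ((norm (f x - ?f R x))\<^sup>2) \<partial>lborel)"])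
    show "\<forall>\<^sub>F R in at_top. (\<integral>\<^sup>+u. ennreal ((norm (g u - fourier_integral (?f R) u))\<^sup>2) \<partial>lborel)
        \<le> C * (\<integral>\<^sup>+x. ennreal ((norm (f x - ?f R x))\<^sup>2) \<partial>lborel)"
    proof (intro always_eventually allI)
      fix R :: real
      note fR_int = integrable_indicator_cball_mult[OF _ f2, of R]
      show "(\<integral>\<^sup>+u. ennreal ((norm (g u - fourier_integral (?f R) u))\<^sup>2) \<partial>lborel)
        \<le> C * (\<integral>\<^sup>+x. ennreal ((norm (f x - ?f R x))\<^sup>2) \<partial>lborel)"
      \<comment> \<open>With \<open>R\<close> fixed, Plancherel's inequality is applied to
        \<open>h n\<close> minus the truncation of \<open>f\<close>. As \<open>n\<close> grows,
        Fatou's lemma handles the left side and dominated convergence the right side.\<close>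
      proof (rule nn_integral_le_lim[where g="\<lambda>n u. ennreal ((norm (fourier_integral (h n) u - fourier_integral (?f R) u))\<^sup>2)"
            and c="\<lambda>n. C * (\<integral>\<^sup>+x. ennreal ((norm (h n x - ?f R x))\<^sup>2) \<partial>lborel)"])
        show "AE u in lborel. (\<lambda>n. ennreal ((norm (fourier_integral (h n) u - fourier_integral (?f R) u))\<^sup>2))
            \<longlonglongrightarrow> ennreal ((norm (g u - fourier_integral (?f R) u))\<^sup>2)"
          using Flim by eventually_elim (intro tendsto_intros)
        have "(\<integral>\<^sup>+u. ennreal ((norm (fourier_integral (\<lambda>x. h n x - ?f R x) u))\<^sup>2) \<partial>lborel)
            \<le> C * (\<integral>\<^sup>+x. ennreal ((norm (h n x - ?f R x))\<^sup>2) \<partial>lborel)" for n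
          unfolding C_def
          by (intro nn_integral_fourier_integral_le Bochner_Integration.integrable_diff h fR_int) measurable
        then show "(\<integral>\<^sup>+u. ennreal ((norm (fourier_integral (h n) u - fourier_integral (?f R) u))\<^sup>2) \<partial>lborel)
            \<le> C * (\<integral>\<^sup>+x. ennreal ((norm (h n x - ?f R x))\<^sup>2) \<partial>lborel)" for n
          by (subst (asm) fourier_integral_diff[OF h fR_int]) auto
        have "(\<lambda>n. \<integral>\<^sup>+x. ennreal ((norm (h n x - ?f R x))\<^sup>2) \<partial>lborel)
            \<longlonglongrightarrow> (\<integral>\<^sup>+x. ennreal ((norm (f x - ?f R x))\<^sup>2) \<partial>lborel)"
        proof (rule nn_integral_dominated_convergence[where w="\<lambda>x. ennreal (4 * (norm (f x))\<^sup>2)"])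
          show "AE x in lborel. ennreal ((norm (h n x - ?f R x))\<^sup>2) \<le> ennreal (4 * (norm (f x))\<^sup>2)" for n
            using le by eventually_elim
              (intro ennreal_leI norm_diff_power2_le, auto simp: norm_mult indicator_def)
          show "AE x in lborel. (\<lambda>n. ennreal ((norm (h n x - ?f R x))\<^sup>2)) \<longlonglongrightarrow> ennreal ((norm (f x - ?f R x))\<^sup>2)"
            using lim by eventually_elim (intro tendsto_intros)
        qed (use fin4 in measurable)
        then show "(\<lambda>n. C * (\<integral>\<^sup>+x. ennreal ((norm (h n x - ?f R x))\<^sup>2) \<partial>lborel))
            \<longlonglongrightarrow> C * (\<integral>\<^sup>+x. ennreal ((norm (f x - ?f R x))\<^sup>2) \<partial>lborel)"
          by (intro ennreal_tendsto_cmult) (auto simp: C_def)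
      qed measurable
    qed
    have "((\<lambda>R. \<integral>\<^sup>+x. ennreal ((norm (f x - ?f R x))\<^sup>2) \<partial>lborel) \<longlongrightarrow> (\<integral>\<^sup>+x. 0 \<partial>(lborel :: 'a measure))) at_top"
    \<comment> \<open>The real parameter is replaced by sequences so that dominated convergence
      applies. At each point the truncation equals \<open>f\<close> once the radius exceeds the norm
      of the point.\<close>
    proof (rule tendsto_at_topI_sequentially)
      fix X :: "nat \<Rightarrow> real" assume X: "filterlim X at_top sequentially"
      show "(\<lambda>n. \<integral>\<^sup>+x. ennreal ((norm (f x - ?f (X n) x))\<^sup>2) \<partial>lborel) \<longlonglongrightarrow> (\<integral>\<^sup>+x. 0 \<partial>(lborel :: 'a measure))"
      proof (rule nn_integral_dominated_convergence[where w="\<lambda>x. ennreal (4 * (norm (f x))\<^sup>2)"])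
        show "AE x in lborel. ennreal ((norm (f x - ?f (X n) x))\<^sup>2) \<le> ennreal (4 * (norm (f x))\<^sup>2)" for n
          by (intro AE_I2 ennreal_leI norm_diff_power2_le) (auto simp: norm_mult indicator_def)
        show "AE x in lborel. (\<lambda>n. ennreal ((norm (f x - ?f (X n) x))\<^sup>2)) \<longlonglongrightarrow> 0"
        proof (intro AE_I2 tendsto_eventually)
          fix x :: 'a
          have "\<forall>\<^sub>F n in sequentially. norm x \<le> X n"
            using X by (simp add: filterlim_at_top)
          then show "\<forall>\<^sub>F n in sequentially. ennreal ((norm (f x - ?f (X n) x))\<^sup>2) = 0"
            by eventually_elim (simp add: indicator_def)
        qed
      qed (use fin4 in measurable)
    qed
    then show "((\<lambda>R. C * (\<integral>\<^sup>+x. ennreal ((norm (f x - ?f R x))\<^sup>2) \<partial>lborel)) \<longlongrightarrow> 0) at_top"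
      using ennreal_tendsto_cmult[of C _ 0 at_top] by (simp add: C_def)
  qed auto
  ultimately show ?thesis by (simp add: is_fourier_L2_def)
qed

section \<open>The harmonizable kernel\<close>

lemma norm_cis_minus_1_power2: "(norm (cis \<theta> - 1))\<^sup>2 = 2 - 2 * cos \<theta>"
  unfolding cmod_power2 using sin_cos_squared_add3[of \<theta>]
  by (simp add: power2_eq_square algebra_simps)

lemma norm_powr_eq: "norm x powr a = ((norm x)\<^sup>2) powr (a / 2)"
proof (cases "x = 0")
  case False
  then have "(norm x)\<^sup>2 = norm x powr 2"
    by (intro powr_numeral[symmetric]) simp
  then show ?thesis by (simp only: powr_powr) simp
qed simp

text \<open>Writing the power of \<open>norm \<xi>\<close> as a Gamma integral reduces the squared
  norm, by Tonelli, to Gaussian integrals. What remains is the integral of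
  \<open>s powr (H - 1) * (1 - exp (- (norm t)\<^sup>2 / (4 * s)))\<close> over
  \<open>s > 0\<close>, which converges at \<open>0\<close> since \<open>H > 0\<close> and at
  infinity since \<open>H < 1\<close>.\<close>

lemma harmonizable_kernel_in_L2:
  fixes t :: "'a::euclidean_space"
  assumes H: "0 < H" "H < 1"
  shows "(\<lambda>\<xi>. (cis (t \<bullet> \<xi>) - 1) / of_real (norm \<xi> powr (H + real DIM('a) / 2))) \<in> L2"
    (is "?f \<in> L2")
proof -
  define a where "a = H + real DIM('a) / 2"
  have a: "0 < a" using H by (simp add: a_def add_pos_nonneg)
  have [measurable]: "?f \<in> borel_measurable borel" by measurable
  \<comment> \<open>The exponent is \<open>a - 1\<close>, not \<open>a / 2 - 1\<close>, because the
    squared modulus contains \<open>((norm \<xi>)\<^sup>2) powr (- a)\<close>.\<close>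
  define G where "G \<xi> s = indicator {0<..} s * (s powr (a - 1) * ((2 - 2 * cos (t \<bullet> \<xi>)) * exp (- s * (norm \<xi>)\<^sup>2)))" for \<xi> s
  have "ennreal (Gamma a) * (\<integral>\<^sup>+\<xi>. ennreal ((norm (?f \<xi>))\<^sup>2) \<partial>lborel)
      = (\<integral>\<^sup>+\<xi>. ennreal (Gamma a) * ennreal ((norm (?f \<xi>))\<^sup>2) \<partial>lborel)"
    by (rule nn_integral_cmult[symmetric]) measurable
  also have "\<dots> = (\<integral>\<^sup>+\<xi>. (\<integral>\<^sup>+s. ennreal (G \<xi> s) \<partial>lborel) \<partial>lborel)"
  proof (rule nn_integral_cong_AE)
    show "AE \<xi> in lborel. ennreal (Gamma a) * ennreal ((norm (?f \<xi>))\<^sup>2) = (\<integral>\<^sup>+s. ennreal (G \<xi> s) \<partial>lborel)"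
      using AE_lborel_singleton[of "0::'a"]
    proof eventually_elim
      case (elim \<xi>)
      have "(norm \<xi> powr a)\<^sup>2 = ((norm \<xi>)\<^sup>2) powr a"
        using elim by (simp add: power2_eq_square powr_mult)
      then have n: "(norm (?f \<xi>))\<^sup>2 = (2 - 2 * cos (t \<bullet> \<xi>)) * ((norm \<xi>)\<^sup>2) powr (- a)"
        by (simp add: norm_divide power_divide norm_cis_minus_1_power2 a_def[symmetric] powr_minus_divide)
      have "(\<integral>\<^sup>+s. ennreal (G \<xi> s) \<partial>lborel)
          = (\<integral>\<^sup>+s. ennreal (2 - 2 * cos (t \<bullet> \<xi>)) * ennreal (indicator {0<..} s * (s powr (a - 1) * exp (- (norm \<xi>)\<^sup>2 * s))) \<partial>lborel)"
        by (intro nn_integral_cong) (simp add: G_def mult_ac flip: ennreal_mult')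
      also have "\<dots> = ennreal (2 - 2 * cos (t \<bullet> \<xi>)) * ennreal (Gamma a * ((norm \<xi>)\<^sup>2) powr (- a))"
        using elim a nn_integral_Gamma_scaled[of a "(norm \<xi>)\<^sup>2"] by (subst nn_integral_cmult) auto
      finally show ?case
        using a by (simp add: n mult_ac Gamma_real_nonneg flip: ennreal_mult')
    qed
  qed
  also have "\<dots> = (\<integral>\<^sup>+s. (\<integral>\<^sup>+\<xi>. ennreal (G \<xi> s) \<partial>lborel) \<partial>lborel)"
    unfolding G_def by (rule lborel_pair.Fubini'[symmetric]) measurable
  \<comment> \<open>The constant \<open>1\<close> is kept as \<open>exp (- 0 / s)\<close> to match
    the difference of exponentials with \<open>p = 0\<close>, and the exponent is that of
    \<open>c = 1 - H\<close>.\<close>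
  also have "\<dots> = (\<integral>\<^sup>+s. ennreal (2 * pi powr (real DIM('a) / 2)) *
      ennreal (indicator {0<..} s * (s powr (- (1 - H)) * (exp (- 0 / s) - exp (- ((norm t)\<^sup>2 / 4) / s)))) \<partial>lborel)"
  proof (rule nn_integral_cong)
    fix s :: real
    show "(\<integral>\<^sup>+\<xi>. ennreal (G \<xi> s) \<partial>lborel) = ennreal (2 * pi powr (real DIM('a) / 2)) *
      ennreal (indicator {0<..} s * (s powr (- (1 - H)) * (exp (- 0 / s) - exp (- ((norm t)\<^sup>2 / 4) / s))))"
    proof (cases "0 < s")
      case True
      let ?c = "(pi / s) powr (real DIM('a) / 2)"
      have I: "has_bochner_integral lborel (\<lambda>\<xi>. cos (y \<bullet> \<xi>) * exp (- s * (norm \<xi>)\<^sup>2)) (?c * exp (- (norm y)\<^sup>2 / (4 * s)))"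
        for y :: 'a
        using has_bochner_integral_Re[OF has_bochner_integral_gaussian_fourier[OF True, of y]]
        by (simp add: inner_commute)
      have "has_bochner_integral lborel (\<lambda>\<xi>. s powr (a - 1) * (2 * (cos (0 \<bullet> \<xi>) * exp (- s * (norm \<xi>)\<^sup>2) - cos (t \<bullet> \<xi>) * exp (- s * (norm \<xi>)\<^sup>2))))
        (s powr (a - 1) * (2 * (?c * exp (- (norm (0::'a))\<^sup>2 / (4 * s)) - ?c * exp (- (norm t)\<^sup>2 / (4 * s)))))"
        by (intro has_bochner_integral_mult_right has_bochner_integral_diff I)
      then have "has_bochner_integral lborel (\<lambda>\<xi>. G \<xi> s) (s powr (a - 1) * (2 * (?c * (1 - exp (- (norm t)\<^sup>2 / (4 * s))))))"
        using True by (simp add: G_def algebra_simps)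
      then have "(\<integral>\<^sup>+\<xi>. ennreal (G \<xi> s) \<partial>lborel) = ennreal (s powr (a - 1) * (2 * (?c * (1 - exp (- (norm t)\<^sup>2 / (4 * s))))))"
        by (subst nn_integral_eq_integral[OF integrable.intros])
           (auto simp only: has_bochner_integral_integral_eq, auto simp: G_def)
      moreover have "s powr (a - 1) * ?c = pi powr (real DIM('a) / 2) * s powr (- (1 - H))"
      proof -
        have "s powr (a - 1) = s powr (- (1 - H)) * s powr (real DIM('a) / 2)"
          unfolding powr_add[symmetric] a_def by (simp add: algebra_simps)
        then show ?thesis using True by (simp add: powr_divide)
      qed
      ultimately show ?thesis
        using True by (simp add: mult_ac flip: ennreal_mult')
    qed (simp add: G_def)
  qed
  also have "\<dots> = ennreal (2 * pi powr (real DIM('a) / 2)) *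
      (ennreal (Gamma (1 - H)) * (\<integral>\<^sup>+x. ennreal (indicator {0..(norm t)\<^sup>2 / 4} x * x powr (- (1 - H))) \<partial>lborel))"
    by (subst nn_integral_cmult, measurable) (subst nn_integral_powr_mult_exp_diff, use H in auto)
  also have "\<dots> < \<infinity>"
  proof -
    have "((\<lambda>x. x powr (- (1 - H))) has_integral (((norm t)\<^sup>2 / 4) powr (- (1 - H) + 1) / (- (1 - H) + 1))) {0..(norm t)\<^sup>2 / 4}"
      using H by (intro has_integral_powr_from_0) auto
    then show ?thesis
      by (subst nn_integral_has_integral_lebesgue) (auto simp: ennreal_mult_less_top)
  qed
  \<comment> \<open>Finiteness passes from the product to the integral because
    \<open>Gamma a\<close> is positive; a factor \<open>0\<close> would hide an infinite
    value.\<close>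
  finally have "(\<integral>\<^sup>+\<xi>. ennreal ((norm (?f \<xi>))\<^sup>2) \<partial>lborel) < \<infinity>"
    using Gamma_real_pos[OF a] by (auto simp: ennreal_mult_less_top)
  then show ?thesis
    by (simp add: L2_def integrable_iff_bounded)
qed

section \<open>The Fourier transform of the harmonizable kernel\<close>

lemma integrable_lborel_pair_mult:
  fixes f :: "'a::euclidean_space \<Rightarrow> real" and g :: "'b::euclidean_space \<Rightarrow> real"
  assumes f: "integrable lborel f" and g: "integrable lborel g"
  shows "integrable (lborel \<Otimes>\<^sub>M lborel) (\<lambda>(x, y). f x * g y)"
proof (rule lborel_pair.Fubini_integrable)
  have [measurable]: "f \<in> borel_measurable borel" "g \<in> borel_measurable borel" using f g by auto
  show "(\<lambda>(x, y). f x * g y) \<in> borel_measurable (lborel \<Otimes>\<^sub>M lborel)" by measurable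
qed (use f g in \<open>auto simp: abs_mult\<close>)

text \<open>Dominated convergence along intervals that exhaust the half-line. It removes the cutoff
  both in the approximants of the kernel and in their Fourier transforms.\<close>

lemma LIMSEQ_integral_exhaust_greaterThan_0:
  fixes \<phi> :: "real \<Rightarrow> real"
  assumes \<phi>: "integrable lborel (\<lambda>s. indicator {0<..} s * \<phi> s)"
  shows "(\<lambda>n. \<integral>s. indicator {1 / real (Suc n)..real (Suc n)} s * \<phi> s \<partial>lborel)
    \<longlonglongrightarrow> (\<integral>s. indicator {0<..} s * \<phi> s \<partial>lborel)"
proof (rule integral_dominated_convergence[where w="\<lambda>s. \<bar>indicator {0<..} s * \<phi> s\<bar>"])
  \<comment> \<open>Measurability is known only for the product of \<open>\<phi>\<close> with the
    indicator of the half-line, so the truncated integrand is expressed through that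
    product.\<close>
  have eq: "indicator {1 / real (Suc n)..real (Suc n)} s * \<phi> s
      = indicator {1 / real (Suc n)..real (Suc n)} s * (indicator {0<..} s * \<phi> s)" for n s
  proof (cases "0 < s")
    case False
    moreover have "0 < 1 / real (Suc n)" by simp
    ultimately have "s \<notin> {1 / real (Suc n)..real (Suc n)}" unfolding atLeastAtMost_iff by linarith
    then have "indicator {1 / real (Suc n)..real (Suc n)} s = (0::real)" by (rule indicator_simps(2))
    then show ?thesis by (simp only: mult_zero_left)
  qed simp
  have [measurable]: "(\<lambda>s. indicator {0<..} s * \<phi> s) \<in> borel_measurable borel" using \<phi> by auto
  show "(\<lambda>s. indicator {1 / real (Suc n)..real (Suc n)} s * \<phi> s) \<in> borel_measurable lborel" for n
    unfolding eq by measurable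
  show "AE s in lborel. norm (indicator {1 / real (Suc n)..real (Suc n)} s * \<phi> s) \<le> \<bar>indicator {0<..} s * \<phi> s\<bar>" for n
    unfolding eq by (auto simp: indicator_def)
  show "AE s in lborel. (\<lambda>n. indicator {1 / real (Suc n)..real (Suc n)} s * \<phi> s) \<longlonglongrightarrow> indicator {0<..} s * \<phi> s"
  proof (intro AE_I2 tendsto_eventually)
    fix s :: real
    show "\<forall>\<^sub>F n in sequentially. indicator {1 / real (Suc n)..real (Suc n)} s * \<phi> s = indicator {0<..} s * \<phi> s"
    proof (cases "0 < s")
      case True
      have "\<forall>\<^sub>F n in sequentially. 1 / real (Suc n) < s"
        using order_tendstoD(2)[OF LIMSEQ_Suc[OF lim_1_over_n] True] by simp
      moreover have "\<forall>\<^sub>F n in sequentially. s \<le> real n"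
        by (rule filterlim_real_sequentially[THEN filterlim_at_top[THEN iffD1], rule_format])
      ultimately show ?thesis
        by eventually_elim (use True in simp)
    next
      case False
      then show ?thesis unfolding eq by simp
    qed
  qed
qed (use \<phi> in auto)

text \<open>The Gamma integral contributes \<open>s powr (a / 2 - 1)\<close> and the Gaussian
  transform \<open>s powr (- DIM('a) / 2)\<close>; together they give \<open>s powr (- c)\<close>.
  The bound \<open>a < DIM('a) + 2\<close> means \<open>c > 0\<close>, and
  \<open>a \<noteq> DIM('a)\<close> means \<open>c \<noteq> 1\<close>. The powers in the result come
  from \<open>1 - c = (a - DIM('a)) / 2\<close>.\<close>

lemma is_fourier_L2_harmonizable_kernel:
  fixes t :: "'a::euclidean_space" and a :: real
  defines "c \<equiv> (real DIM('a) - a) / 2 + 1"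
  assumes a: "0 < a" "a < real DIM('a) + 2" "a \<noteq> real DIM('a)"
    and f: "(\<lambda>\<xi>. (cis (t \<bullet> \<xi>) - 1) / of_real (norm \<xi> powr a)) \<in> L2" (is "?f \<in> L2")
  shows "is_fourier_L2 (\<lambda>\<xi>. (cis (t \<bullet> \<xi>) - 1) / of_real (norm \<xi> powr a))
    (\<lambda>u. of_real (pi powr (real DIM('a) / 2) / Gamma (a / 2) * (Gamma c / (c - 1)) * (1 / 4) powr (1 - c)
      * (norm (t - u) powr (a - real DIM('a)) - norm u powr (a - real DIM('a)))))"
    (is "is_fourier_L2 _ ?g")
proof -
  have c: "0 < c" "c \<noteq> 1" using a by (auto simp: c_def field_simps)
  define N where "N = real DIM('a)"
  define I where "I n = indicat_real {1 / real (Suc n)..real (Suc n)}" for n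
  define E where "E \<xi> = cis (t \<bullet> \<xi>) - 1" for \<xi>
  have E_le: "norm (E \<xi>) \<le> 2" for \<xi>
    using norm_triangle_ineq4[of "cis (t \<bullet> \<xi>)" 1] by (simp add: E_def)
  have [measurable]: "E \<in> borel_measurable borel" unfolding E_def[abs_def] by measurable
  have [measurable]: "I n \<in> borel_measurable borel" for n unfolding I_def by measurable
  \<comment> \<open>This is the Gamma integral for \<open>norm \<xi> powr (- a)\<close> with
    \<open>s\<close> cut off away from \<open>0\<close> and infinity; \<open>h n\<close> is the
    resulting integrable approximant and \<open>F n\<close> its integrand before division by
    \<open>Gamma (a / 2)\<close>.\<close>
  define w where "w n \<xi> = (\<integral>s. I n s * (s powr (a / 2 - 1) * exp (- (norm \<xi>)\<^sup>2 * s)) \<partial>lborel)" for n and \<xi> :: 'a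
  define h where "h n \<xi> = E \<xi> * of_real (w n \<xi> / Gamma (a / 2))" for n \<xi>
  define F where "F n \<xi> s = E \<xi> * of_real (I n s * (s powr (a / 2 - 1) * exp (- (norm \<xi>)\<^sup>2 * s)))" for n \<xi> s
  have [measurable]: "(\<lambda>(\<xi>, s). F n \<xi> s) \<in> borel_measurable (borel \<Otimes>\<^sub>M borel)" for n
    unfolding F_def by measurable
  have Ga: "0 < Gamma (a / 2)" using a by (intro Gamma_real_pos) simp
  have I_integrable: "integrable lborel (\<lambda>s. I n s * s powr (a / 2 - 1))" for n
  proof -
    have "set_integrable lborel {1 / real (Suc n)..real (Suc n)} (\<lambda>s. s powr (a / 2 - 1))"
      by (intro borel_integrable_atLeastAtMost' continuous_intros)
         (auto simp: divide_le_0_iff)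
    then show ?thesis by (simp add: set_integrable_def I_def)
  qed
  \<comment> \<open>On the cutoff interval \<open>s \<ge> 1 / (n + 1)\<close>, so a single Gaussian
    in \<open>\<xi>\<close> dominates and the majorant is a product. Taking \<open>z = 1\<close>
    yields integrability of \<open>h n\<close>; taking a character for \<open>z\<close> justifies
    Fubini in its Fourier integral.\<close>
  have pair: "integrable (lborel \<Otimes>\<^sub>M lborel) (\<lambda>(\<xi>, s). z \<xi> * F n \<xi> s)"
    if z: "\<And>\<xi>. norm (z \<xi>) \<le> 1" and [measurable]: "z \<in> borel_measurable borel" for z n
  proof (rule Bochner_Integration.integrable_bound)
    show "integrable (lborel \<Otimes>\<^sub>M lborel)
        (\<lambda>(\<xi>::'a, s). (2 * exp (- (1 / real (Suc n)) * (norm \<xi>)\<^sup>2)) * (I n s * s powr (a / 2 - 1)))"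
      by (intro integrable_lborel_pair_mult integrable_mult_right integrable_gaussian I_integrable) simp
    show "(\<lambda>(\<xi>, s). z \<xi> * F n \<xi> s) \<in> borel_measurable (lborel \<Otimes>\<^sub>M lborel)" by measurable
    show "AE p in lborel \<Otimes>\<^sub>M lborel. norm (case p of (\<xi>, s) \<Rightarrow> z \<xi> * F n \<xi> s) \<le>
        norm (case p of (\<xi>, s) \<Rightarrow> 2 * exp (- (1 / real (Suc n)) * (norm \<xi>)\<^sup>2) * (I n s * s powr (a / 2 - 1)))"
    proof (intro AE_I2, clarify)
      fix \<xi> :: 'a and s :: real
      show "norm (z \<xi> * F n \<xi> s) \<le> norm (2 * exp (- (1 / real (Suc n)) * (norm \<xi>)\<^sup>2) * (I n s * s powr (a / 2 - 1)))"
      proof (cases "s \<in> {1 / real (Suc n)..real (Suc n)}")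
        case True
        then have e: "exp (- (norm \<xi>)\<^sup>2 * s) \<le> exp (- (1 / real (Suc n)) * (norm \<xi>)\<^sup>2)"
          using mult_left_mono[of "1 / real (Suc n)" s "(norm \<xi>)\<^sup>2"] by (simp add: mult.commute)
        have "norm (z \<xi> * F n \<xi> s) = norm (z \<xi>) * norm (E \<xi>) * exp (- (norm \<xi>)\<^sup>2 * s) * s powr (a / 2 - 1)"
          using True by (simp add: F_def I_def norm_mult)
        also have "\<dots> \<le> 1 * 2 * exp (- (1 / real (Suc n)) * (norm \<xi>)\<^sup>2) * s powr (a / 2 - 1)"
          by (intro mult_mono z E_le e) auto
        also have "\<dots> = norm (2 * exp (- (1 / real (Suc n)) * (norm \<xi>)\<^sup>2) * (I n s * s powr (a / 2 - 1)))"
          using True by (simp add: I_def)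
        finally show ?thesis .
      next
        case False
        then have "I n s = 0" unfolding I_def by (rule indicator_simps(2))
        then show ?thesis by (simp add: F_def)
      qed
    qed
  qed
  have h_eq: "h n \<xi> = (\<integral>s. F n \<xi> s \<partial>lborel) / of_real (Gamma (a / 2))" for n \<xi>
    by (simp only: h_def F_def w_def integral_mult_right_zero integral_complex_of_real of_real_divide times_divide_eq_right)
  have h_int: "integrable lborel (h n)" for n
  proof -
    have "integrable lborel (\<lambda>\<xi>. \<integral>s. F n \<xi> s \<partial>lborel)"
      using lborel_pair.integrable_fst'[OF pair[of "\<lambda>_. 1" n]] by simp
    then show ?thesis unfolding h_eq[abs_def] by (rule integrable_divide_zero)
  qed
  \<comment> \<open>Multiplication by \<open>cis (t \<bullet> \<xi>) - 1\<close> turns the Gaussian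
    transform into a difference of Gaussians in \<open>u\<close>, centered at \<open>t\<close> and
    at \<open>0\<close>.\<close>
  have h_Fourier: "fourier_integral (h n) u =
      of_real ((\<integral>s. I n s * (pi powr (N / 2) * (s powr (- c) * (exp (- ((norm (t - u))\<^sup>2 / 4) / s) - exp (- ((norm u)\<^sup>2 / 4) / s)))) \<partial>lborel) / Gamma (a / 2))" for n u
  proof -
    have "fourier_integral (h n) u = (\<integral>\<xi>. (\<integral>s. cis (- (\<xi> \<bullet> u)) * F n \<xi> s \<partial>lborel) \<partial>lborel) / of_real (Gamma (a / 2))"
      unfolding fourier_integral_def h_eq by simp
    also have "(\<integral>\<xi>. (\<integral>s. cis (- (\<xi> \<bullet> u)) * F n \<xi> s \<partial>lborel) \<partial>lborel) = (\<integral>s. (\<integral>\<xi>. cis (- (\<xi> \<bullet> u)) * F n \<xi> s \<partial>lborel) \<partial>lborel)"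
      by (rule lborel_pair.Fubini_integral[symmetric]) (rule pair, auto)
    also have "\<dots> = (\<integral>s. of_real (I n s * (pi powr (N / 2) * (s powr (- c) * (exp (- ((norm (t - u))\<^sup>2 / 4) / s) - exp (- ((norm u)\<^sup>2 / 4) / s))))) \<partial>lborel)"
    proof (rule Bochner_Integration.integral_cong[OF refl])
      fix s :: real
      show "(\<integral>\<xi>. cis (- (\<xi> \<bullet> u)) * F n \<xi> s \<partial>lborel)
          = of_real (I n s * (pi powr (N / 2) * (s powr (- c) * (exp (- ((norm (t - u))\<^sup>2 / 4) / s) - exp (- ((norm u)\<^sup>2 / 4) / s)))))"
      proof (cases "s \<in> {1 / real (Suc n)..real (Suc n)}")
        case True
        moreover have "0 < 1 / real (Suc n)" by simp
        ultimately have s: "0 < s" unfolding atLeastAtMost_iff by linarith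
        let ?G = "\<lambda>y. of_real ((pi / s) powr (real DIM('a) / 2) * exp (- (norm y)\<^sup>2 / (4 * s))) :: complex"
        have "has_bochner_integral lborel
           (\<lambda>\<xi>. of_real (s powr (a / 2 - 1)) * (cis (- (\<xi> \<bullet> (u - t))) * of_real (exp (- s * (norm \<xi>)\<^sup>2)) - cis (- (\<xi> \<bullet> u)) * of_real (exp (- s * (norm \<xi>)\<^sup>2))))
           (of_real (s powr (a / 2 - 1)) * (?G (u - t) - ?G u))"
          by (intro has_bochner_integral_mult_right has_bochner_integral_diff has_bochner_integral_gaussian_fourier s)
        moreover have "of_real (s powr (a / 2 - 1)) * (cis (- (\<xi> \<bullet> (u - t))) * of_real (exp (- s * (norm \<xi>)\<^sup>2)) - cis (- (\<xi> \<bullet> u)) * of_real (exp (- s * (norm \<xi>)\<^sup>2)))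
            = cis (- (\<xi> \<bullet> u)) * F n \<xi> s" for \<xi>
        proof -
          have "cis (- (\<xi> \<bullet> (u - t))) = cis (- (\<xi> \<bullet> u)) * cis (t \<bullet> \<xi>)"
            by (simp add: cis_mult inner_diff_right inner_commute)
          then show ?thesis
            using True by (simp add: F_def I_def E_def algebra_simps)
        qed
        moreover have "of_real (s powr (a / 2 - 1)) * (?G (u - t) - ?G u)
            = of_real (I n s * (pi powr (N / 2) * (s powr (- c) * (exp (- ((norm (t - u))\<^sup>2 / 4) / s) - exp (- ((norm u)\<^sup>2 / 4) / s)))))"
        proof -
          have "s powr (a / 2 - 1) = s powr (- c) * s powr (N / 2)"
            unfolding powr_add[symmetric] c_def N_def by (simp add: diff_divide_distrib)
          then have "s powr (a / 2 - 1) * (pi / s) powr (N / 2) = pi powr (N / 2) * s powr (- c)"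
            using s by (simp add: powr_divide)
          moreover have "I n s = 1" using True by (simp add: I_def)
          moreover have "of_real (s powr (a / 2 - 1)) * (?G (u - t) - ?G u)
            = of_real ((s powr (a / 2 - 1) * (pi / s) powr (N / 2)) * (exp (- ((norm (t - u))\<^sup>2 / 4) / s) - exp (- ((norm u)\<^sup>2 / 4) / s)))"
            by (simp add: norm_minus_commute[of u t] N_def right_diff_distrib mult.assoc)
          ultimately show ?thesis by (simp only: mult.assoc mult_1_left)
        qed
        ultimately show ?thesis
          by (simp only: has_bochner_integral_integral_eq)
      next
        case False
        then have "I n s = 0" unfolding I_def by (rule indicator_simps(2))
        then show ?thesis by (simp add: F_def)
      qed
    qed
    finally show ?thesis
      by (simp only: integral_complex_of_real of_real_divide)
  qed
  have w: "has_bochner_integral lborel (\<lambda>s. indicator {0<..} s * (s powr (a / 2 - 1) * exp (- (norm \<xi>)\<^sup>2 * s)))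
      (Gamma (a / 2) * norm \<xi> powr (- a))" if "\<xi> \<noteq> 0" for \<xi> :: 'a
  proof (rule has_bochner_integral_nn_integral)
    show "(\<integral>\<^sup>+s. ennreal (indicator {0<..} s * (s powr (a / 2 - 1) * exp (- (norm \<xi>)\<^sup>2 * s))) \<partial>lborel)
        = ennreal (Gamma (a / 2) * norm \<xi> powr (- a))"
      using that a nn_integral_Gamma_scaled[of "a / 2" "(norm \<xi>)\<^sup>2"] by (simp add: norm_powr_eq[of \<xi> "- a"])
  qed (use Ga in auto)
  show ?thesis
  proof (rule is_fourier_L2_pointwise_limit[OF f h_int])
    show "?g \<in> borel_measurable borel" by measurable
    show "AE \<xi> in lborel. \<forall>n. norm (h n \<xi>) \<le> norm (?f \<xi>)"
      using AE_lborel_singleton[of "0::'a"]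
    proof (eventually_elim, intro allI)
      case (elim \<xi>) fix n
      note W = w[OF elim]
      have I_nonneg: "0 \<le> I n s" for s by (simp add: I_def)
      have I_le: "I n s \<le> indicator {0<..} s" for s
      proof (cases "s \<in> {1 / real (Suc n)..real (Suc n)}")
        case True
        moreover have "0 < 1 / real (Suc n)" by simp
        ultimately have "0 < s" unfolding atLeastAtMost_iff by linarith
        then show ?thesis by (simp add: I_def indicator_def)
      next
        case False
        then have "I n s = 0" unfolding I_def by (rule indicator_simps(2))
        then show ?thesis by simp
      qed
      have "w n \<xi> \<le> (\<integral>s. indicator {0<..} s * (s powr (a / 2 - 1) * exp (- (norm \<xi>)\<^sup>2 * s)) \<partial>lborel)"
        unfolding w_def
      proof (rule Bochner_Integration.integral_mono')
        show "I n s * (s powr (a / 2 - 1) * exp (- (norm \<xi>)\<^sup>2 * s)) \<le> indicator {0<..} s * (s powr (a / 2 - 1) * exp (- (norm \<xi>)\<^sup>2 * s))" for s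
          by (intro mult_right_mono I_le) simp
      qed (use W in \<open>auto simp: has_bochner_integral_iff\<close>)
      then have "w n \<xi> / Gamma (a / 2) \<le> norm \<xi> powr (- a)"
        unfolding has_bochner_integral_integral_eq[OF W] using Ga by (simp only: divide_le_eq mult.commute if_True)
      moreover have "0 \<le> w n \<xi> / Gamma (a / 2)"
        unfolding w_def using Ga I_nonneg by (intro divide_nonneg_pos integral_nonneg) auto
      ultimately show "norm (h n \<xi>) \<le> norm (?f \<xi>)"
      proof -
        assume le: "w n \<xi> / Gamma (a / 2) \<le> norm \<xi> powr (- a)" and nn: "0 \<le> w n \<xi> / Gamma (a / 2)"
        have "norm (h n \<xi>) = norm (E \<xi>) * (w n \<xi> / Gamma (a / 2))"
          unfolding h_def norm_mult norm_of_real abs_of_nonneg[OF nn] ..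
        also have "\<dots> \<le> norm (E \<xi>) * norm \<xi> powr (- a)"
          by (intro mult_left_mono le) simp
        also have "\<dots> = norm (?f \<xi>)"
          by (simp add: E_def norm_divide powr_minus_divide)
        finally show ?thesis .
      qed
    qed
    show "AE \<xi> in lborel. (\<lambda>n. h n \<xi>) \<longlonglongrightarrow> ?f \<xi>"
      using AE_lborel_singleton[of "0::'a"]
    proof eventually_elim
      case (elim \<xi>)
      note W = w[OF elim]
      have "(\<lambda>n. w n \<xi>) \<longlonglongrightarrow> Gamma (a / 2) * norm \<xi> powr (- a)"
        using LIMSEQ_integral_exhaust_greaterThan_0[OF integrable.intros[OF W]]
        by (simp only: w_def I_def has_bochner_integral_integral_eq[OF W])
      then have "(\<lambda>n. h n \<xi>) \<longlonglongrightarrow> E \<xi> * of_real (Gamma (a / 2) * norm \<xi> powr (- a) / Gamma (a / 2))"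
        unfolding h_def using Ga by (intro tendsto_intros) auto
      then show ?case
        using Ga by (simp add: E_def powr_minus_divide)
    qed
    show "AE u in lborel. (\<lambda>n. fourier_integral (h n) u) \<longlonglongrightarrow> ?g u"
      \<comment> \<open>Off these two points both \<open>?p\<close> and \<open>?q\<close> are
        positive, as the evaluation of the limiting integral requires.\<close>
      using AE_lborel_singleton[of "0::'a"] AE_lborel_singleton[of t]
    proof eventually_elim
      case (elim u)
      let ?p = "(norm (t - u))\<^sup>2 / 4" and ?q = "(norm u)\<^sup>2 / 4"
      let ?r = "Gamma c / (c - 1) * (?p powr (1 - c) - ?q powr (1 - c))"
      have B: "has_bochner_integral lborel
          (\<lambda>s. pi powr (N / 2) * (indicator {0<..} s * (s powr (- c) * (exp (- ?p / s) - exp (- ?q / s))))) (pi powr (N / 2) * ?r)"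
        using elim by (intro has_bochner_integral_mult_right has_bochner_integral_powr_mult_exp_diff c) auto
      then have B: "has_bochner_integral lborel
          (\<lambda>s. indicator {0<..} s * (pi powr (N / 2) * (s powr (- c) * (exp (- ?p / s) - exp (- ?q / s))))) (pi powr (N / 2) * ?r)"
        by (simp only: mult.left_commute)
      have "(\<lambda>n. fourier_integral (h n) u) \<longlonglongrightarrow> of_real (pi powr (N / 2) * ?r / Gamma (a / 2))"
        unfolding h_Fourier I_def
        using LIMSEQ_integral_exhaust_greaterThan_0[OF integrable.intros[OF B]] Ga
        by (intro tendsto_intros) (auto simp only: has_bochner_integral_integral_eq[OF B])
      moreover have "((norm x)\<^sup>2 / 4) powr (1 - c) = (1 / 4) powr (1 - c) * norm x powr (a - N)" for x :: 'a
      proof -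
        have "norm x powr (a - N) = ((norm x)\<^sup>2) powr (1 - c)"
          by (subst norm_powr_eq) (simp add: c_def N_def field_simps)
        moreover have "(norm x)\<^sup>2 / 4 = 1 / 4 * (norm x)\<^sup>2" by simp
        ultimately show ?thesis by (simp only: powr_mult zero_le_power2 zero_le_divide_1_iff zero_le_numeral)
      qed
      then have "pi powr (N / 2) * ?r / Gamma (a / 2) = pi powr (N / 2) / Gamma (a / 2) * (Gamma c / (c - 1)) * (1 / 4) powr (1 - c)
          * (norm (t - u) powr (a - N) - norm u powr (a - N))"
        by (simp only: right_diff_distrib[symmetric]) (simp add: mult_ac)
      ultimately show ?case by (simp only: N_def)
    qed
  qed
qed

section \<open>Proportionality of the two fields\<close>

lemma L2_cmult:
  assumes "f \<in> L2"
  shows "(\<lambda>u. z * f u) \<in> L2"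
  using assms by (auto simp: L2_def norm_mult power_mult_distrib intro: borel_measurable_times)

lemma L2_AE_cong:
  assumes "f \<in> L2" and [measurable]: "g \<in> borel_measurable borel" and eq: "AE u in lborel. f u = g u"
  shows "g \<in> L2"
proof -
  have [measurable]: "f \<in> borel_measurable borel" and "integrable lborel (\<lambda>u. (norm (f u))\<^sup>2)"
    using assms(1) by (auto simp: L2_def)
  moreover have "integrable lborel (\<lambda>u. (norm (f u))\<^sup>2) \<longleftrightarrow> integrable lborel (\<lambda>u. (norm (g u))\<^sup>2)"
    by (intro integrable_cong_AE) (use eq in auto)
  ultimately show ?thesis by (simp add: L2_def)
qed

text \<open>Any witness \<open>g\<close> guarantees that the representative chosen by
  \<open>SOME\<close> satisfies its specification, and uniqueness then ties the representative to
  \<open>g\<close>.\<close>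

lemma fourier_L2_eqI:
  assumes "f \<in> borel_measurable borel" and g: "is_fourier_L2 f g"
  shows "fourier_L2 f \<in> L2" and "AE u in lborel. fourier_L2 f u = g u"
proof -
  have F: "is_fourier_L2 f (fourier_L2 f)"
    unfolding fourier_L2_def using g by (rule someI[of "is_fourier_L2 f"])
  then show "fourier_L2 f \<in> L2" by (simp add: is_fourier_L2_def)
  show "AE u in lborel. fourier_L2 f u = g u"
    by (rule is_fourier_L2_unique[OF assms(1) F g])
qed

text \<open>The constant is chosen before the functional \<open>V\<close>. It therefore serves all
  sample functionals \<open>\<lambda>f. W f \<omega>\<close> at once and is deterministic.\<close>

lemma moving_average_proportional_harmonizable:
  fixes t :: "real ^ 'n" and H :: real
  assumes H: "0 < H" "H < 1"
  shows "\<exists>l::real. \<forall>V :: (real ^ 'n \<Rightarrow> complex) \<Rightarrow> complex.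
    (\<forall>f\<in>L2. \<forall>g\<in>L2. (AE u in lborel. f u = g u) \<longrightarrow> V f = V g) \<longrightarrow>
    (\<forall>f\<in>L2. \<forall>g\<in>L2. \<forall>a b. V (\<lambda>u. a * f u + b * g u) = a * V f + b * V g) \<longrightarrow>
    V (\<lambda>u. of_real (norm (t - u) powr (H - real CARD('n) / 2) - norm u powr (H - real CARD('n) / 2)))
    = of_real l * V (fourier_L2 (\<lambda>\<xi>. (exp (\<i> * of_real (t \<bullet> \<xi>)) - 1) / of_real (norm \<xi> powr (H + real CARD('n) / 2))))"
    (is "\<exists>l::real. \<forall>V. ?C V \<longrightarrow> ?L V \<longrightarrow> V ?k = of_real l * V (fourier_L2 ?f)")
proof (cases "H = real CARD('n) / 2")
  case True
  have Z: "(\<lambda>u::real^'n. 0) \<in> L2" by (simp add: L2_def)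
  \<comment> \<open>Both exponents are \<open>0\<close>, so away from \<open>0\<close> and
    \<open>t\<close> the kernel is \<open>1 - 1\<close>. At those points
    \<open>0 powr 0 = 0\<close>, hence the exclusion.\<close>
  have k: "AE u in lborel. 0 = ?k u"
    using AE_lborel_singleton[of "0::real^'n"] AE_lborel_singleton[of t]
    by eventually_elim (simp add: True)
  have kL2: "?k \<in> L2" by (rule L2_AE_cong[OF Z _ k]) measurable
  have "V ?k = of_real 0 * V (fourier_L2 ?f)" if C: "?C V" and L: "?L V" for V
  proof -
    have "V (\<lambda>u. 0 * 0 + 0 * 0) = 0 * V (\<lambda>u. 0) + 0 * V (\<lambda>u. 0)"
      by (rule L[rule_format, OF Z Z])
    then have "V (\<lambda>u. 0) = 0" by simp
    moreover have "V (\<lambda>u. 0) = V ?k"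
      by (rule C[rule_format, OF Z kL2 k])
    ultimately show ?thesis by simp
  qed
  then show ?thesis by blast
next
  case False
  define N where "N = real CARD('n)"
  define a where "a = H + N / 2"
  have N: "1 \<le> N" unfolding N_def by (simp add: Suc_leI)
  have a: "0 < a" "a < real DIM(real^'n) + 2" "a \<noteq> real DIM(real^'n)"
    using H N False by (auto simp: a_def N_def)
  have f_eq: "?f = (\<lambda>\<xi>. (cis (t \<bullet> \<xi>) - 1) / of_real (norm \<xi> powr a))"
    by (simp add: cis_conv_exp a_def N_def)
  have fL2: "?f \<in> L2"
    using harmonizable_kernel_in_L2[OF H, of t] by (simp add: cis_conv_exp)
  define c where "c = (real DIM(real^'n) - a) / 2 + 1"
  define C where "C = pi powr (real DIM(real^'n) / 2) / Gamma (a / 2) * (Gamma c / (c - 1)) * (1 / 4) powr (1 - c)"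
  have exp: "a - real DIM(real^'n) = H - real CARD('n) / 2"
    by (simp add: a_def N_def)
  have "is_fourier_L2 ?f (\<lambda>u. of_real C * ?k u)"
    using is_fourier_L2_harmonizable_kernel[OF a fL2[unfolded f_eq]]
    unfolding f_eq c_def[symmetric] C_def[symmetric] exp of_real_mult .
  then have F: "fourier_L2 ?f \<in> L2" "AE u in lborel. fourier_L2 ?f u = of_real C * ?k u"
    using fL2 by (intro fourier_L2_eqI; simp add: L2_def)+
  have c: "0 < c" "c \<noteq> 1" using a by (auto simp: c_def field_simps)
  have "Gamma c \<noteq> 0" "Gamma (a / 2) \<noteq> 0"
    using Gamma_real_pos[OF c(1)] Gamma_real_pos[of "a / 2"] a(1) by (metis half_gt_zero less_irrefl)+
  \<comment> \<open>Both Gamma values have positive arguments and are nonzero. The sign of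
    \<open>C\<close> is that of \<open>c - 1\<close>, so \<open>C\<close> may be negative.\<close>
  then have C: "C \<noteq> 0" using c by (simp add: C_def)
  have G: "(\<lambda>u. of_real (1 / C) * fourier_L2 ?f u) \<in> L2"
    by (rule L2_cmult[OF F(1)])
  have eq: "AE u in lborel. of_real (1 / C) * fourier_L2 ?f u = ?k u"
    using F(2) by eventually_elim (use C in simp)
  \<comment> \<open>The moving average kernel inherits square-integrability from the Fourier
    transform of which it is almost everywhere a multiple; no direct estimate is made.\<close>
  have kL2: "?k \<in> L2"
    by (rule L2_AE_cong[OF G _ eq]) measurable
  have "V ?k = of_real (1 / C) * V (fourier_L2 ?f)" if VC: "?C V" and VL: "?L V" for V
  proof -
    have "V ?k = V (\<lambda>u. of_real (1 / C) * fourier_L2 ?f u)"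
      by (rule VC[rule_format, OF G kL2 eq, symmetric])
    \<comment> \<open>A zero term is added because linearity is formulated for combinations of two
      functions.\<close>
    also have "\<dots> = V (\<lambda>u. of_real (1 / C) * fourier_L2 ?f u + 0 * fourier_L2 ?f u)"
      by simp
    also have "\<dots> = of_real (1 / C) * V (fourier_L2 ?f) + 0 * V (fourier_L2 ?f)"
      by (rule VL[rule_format, OF F(1) F(1)])
    finally show ?thesis by simp
  qed
  then show ?thesis by blast
qed

theorem proposition8:
  fixes M :: "'w measure"
    and W :: "(real ^ 'n \<Rightarrow> complex) \<Rightarrow> 'w \<Rightarrow> complex"
    and H :: "real ^ 'n \<Rightarrow> real"
  assumes "complex_isonormal M W"
    and "H \<in> borel_measurable lebesgue"
    and "\<And>t. 0 < H t \<and> H t < 1"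
  shows "\<exists>l :: real ^ 'n \<Rightarrow> real.
    indistinguishable M nonneg_orthant (moving_average_field H W)
      (\<lambda>t \<omega>. of_real (l t) * harmonizable_field H W t \<omega>)"
proof -
  interpret complex_isonormal M W by (rule assms(1))
  define Q where "Q t l \<longleftrightarrow> (\<forall>V.
    (\<forall>f\<in>L2. \<forall>g\<in>L2. (AE u in lborel. f u = g u) \<longrightarrow> V f = V g) \<longrightarrow>
    (\<forall>f\<in>L2. \<forall>g\<in>L2. \<forall>a b. V (\<lambda>u. a * f u + b * g u) = a * V f + b * V g) \<longrightarrow>
    V (\<lambda>u. of_real (norm (t - u) powr (H t - real CARD('n) / 2) - norm u powr (H t - real CARD('n) / 2)))
    = of_real l * V (fourier_L2 (\<lambda>\<xi>. (exp (\<i> * of_real (t \<bullet> \<xi>)) - 1) / of_real (norm \<xi> powr (H t + real CARD('n) / 2)))))"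
    for t :: "real ^ 'n" and l :: real
  have "\<exists>l. Q t l" for t
    unfolding Q_def using assms(3)[of t] by (intro moving_average_proportional_harmonizable) auto
  \<comment> \<open>The choice is made for each \<open>t\<close> without reference to a sample
    point, which makes \<open>l\<close> a deterministic function.\<close>
  then obtain l where "\<And>t. Q t (l t)" by metis
  note l = this[unfolded Q_def]
  have "indistinguishable M nonneg_orthant (moving_average_field H W)
      (\<lambda>t \<omega>. of_real (l t) * harmonizable_field H W t \<omega>)"
    unfolding indistinguishable_def
    \<comment> \<open>The exceptional sets of these two properties are independent of the index
      functions, so one null set works for all \<open>t\<close> simultaneously. This gives
      indistinguishability and not merely equality almost surely at each \<open>t\<close>.\<close>
    using AE_cong linear
  proof eventually_elim
    case (elim \<omega>)
    show ?case
      unfolding moving_average_field_def harmonizable_field_def fourier_process_def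
      by (rule ballI) (rule l[THEN spec[where x="\<lambda>f. W f \<omega>"], THEN mp, THEN mp, OF elim])
  qed
  then show ?thesis by blast
qed

end
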